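(* Let $\lambda_1,\lambda_2>0$ and let $\lambda=\operatorname{diag}\{\lambda_1,\lambda_2\}$, so that $\lambda I$ acts on $\mathcal H_{K_1}\times\mathcal H_{K_2}$ by $(\phi,\psi)\mapsto(\lambda_1\phi,\lambda_2\psi)$. Let $(V,W)\in\mathcal H_{K_1}\times\mathcal H_{K_2}$. (1) The minimization problem $$\min_{(\phi,\psi)\in\mathcal H_{K_1}\times\mathcal H_{K_2}} R_\lambda(\phi,\psi),\qquad R_\lambda(\phi,\psi)=\|A(\phi,\psi)-A(V,W)\|_{L^2}^2+\lambda_1\|\phi\|_{\mathcal H_{K_1}}^2+\lambda_2\|\psi\|_{\mathcal H_{K_2}}^2,$$ has a unique solution $(V_\lambda^*,W_\lambda^* )$, and $$(V_\lambda^*,W_\lambda^* )=(B+\lambda I)^{-1}B(V,W).$$ (2) The minimization problem $\min_{(\phi,\psi)\in\mathcal H_{K_1}\times\mathcal H_{K_2}}\widehat R_{\lambda,NL}(\phi,\psi)$ with $$\widehat R_{\lambda,NL}(\phi,\psi)=\frac{T|\Omega|}{NL}\sum_{l=1}^{L}\sum_{n=1}^{N}\big|A^\delta(\phi,\psi)(t_l,x_n)-f^\delta(t_l,x_n)\big|^2\rho_{t_l}(x_n)+\lambda_1\|\phi\|_{\mathcal H_{K_1}}^2+\lambda_2\|\psi\|_{\mathcal H_{K_2}}^2$$ has a unique solution $(\widehat V_{\lambda,NL},\widehat W_{\lambda,NL})$, and $$(\widehat V_{\lambda,NL},\widehat W_{\lambda,NL})=\sqrt{\tfrac{T|\Omega|}{NL}}\,\big(B_{NL}^\delta+\lambda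 I\big)^{-1}A_{NL}^{\delta *}f_{NL}^\delta .$$
   Context: Kernels. $K_1,K_2$ are Mercer kernels (continuous, symmetric, positive semidefinite) on $\mathbb R^d\times\mathbb R^d$ with reproducing kernel Hilbert spaces (RKHS) $\mathcal H_{K_1},\mathcal H_{K_2}$; $\mathcal H_{K_1}\times\mathcal H_{K_2}$ carries the product Hilbert structure. For part (1), $K_1,K_2\in C_b^5(\mathbb R^d\times\mathbb R^d)$ ($C^5$ with bounded derivatives); for part (2), $d=1$ and $K_1,K_2$ are of class $C^4$ on $\Omega\times\Omega$ (understood at all arguments at which the kernels are evaluated). Densities. $T>0$; $\{\rho_t\}_{t\in[0,T]}$, $\rho_t=\rho(t,\cdot)$, is a family of probability densities with $\sup_t\|\rho_t\|_{C_b^1}<\infty$ (for part (2), $\sup_t\|\rho_t\|_{C_b^2}<\infty$). Continuous operators. $\Delta_{\rho}g=\nabla\cdot(\rho\nabla g)$; $(\psi*\rho_t)(x)=\int\psi(x-z)\rho_t(z)\,dz$; $(K*\rho_t)(x,y)=\int K(x-z,y)\rho_t(z)\,dz$; the superscript $(1,0)$ means that an operator is applied to the first variable of a kernel. $L^2$ is the space of functions $g$ on $[0,T]\times\mathbb R^d$ with $\|g\|_{L^2}^2=\int_0^T\int_{\mathbb R^d}|g(t,x)|^2\rho_t(x)\,dx\,dt<\infty$. $A:\mathcal H_{K_1}\times\mathcal H_{K_2}\to L^2$ is $A(\phi,\psi)(t,x)=\Delta_{\rho_t}(\phi+\psi*\rho_t)(x)$ and $B=A^*A$, i.e. $$B(\phi,\psi)=\int_0^T\int_{\mathbb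 R^d}\Delta_{\rho_t}(\phi+\psi*\rho_t)(x)\,\big(\Delta_{\rho_t}^{(1,0)}K_1(x,\cdot),\ \Delta_{\rho_t}^{(1,0)}(K_2*\rho_t)(x,\cdot)\big)\rho_t(x)\,dx\,dt .$$ Discrete setting ($d=1$). $\Omega=[a,b]$, $|\Omega|=b-a$, $\Delta x=|\Omega|/N$, $\Delta t=T/L$, $x_n=a+n\Delta x$, $t_l=l\Delta t$ ($1\le n\le N$, $1\le l\le L$), $\rho_l^n=\rho(t_l,x_n)>0$. Forward differences: $(\delta_t^+\rho)_l^n=(\rho_{l+1}^n-\rho_l^n)/\Delta t$ for $l<L$ and $-\rho_l^n/\Delta t$ for $l=L$; $(\delta_x^+\rho)_l^n=(\rho_l^{n+1}-\rho_l^n)/\Delta x$ for $n<N$ and $-\rho_l^n/\Delta x$ for $n=N$; $(\delta_{tt}^+\rho)_l^n=((\delta_t^+\rho)_{l+1}^n-(\delta_t^+\rho)_l^n)/\Delta t$ for $l<L$ and $-(\delta_t^+\rho)_l^n/\Delta t$ for $l=L$. Then $$A^\delta(\phi,\psi)(t_l,x_n)=(\delta_x^+\rho)_l^n\,\partial_x(\phi+\psi*\rho_{t_l})(x_n)+\rho_l^n\,\partial_{xx}(\phi+\psi*\rho_{t_l})(x_n),$$ $A_{NL}^\delta:\mathcal H_{K_1}\times\mathcal H_{K_2}\to\mathbb R^{NL}$, $A_{NL}^\delta(\phi,\psi)=\sqrt{T|\Omega|/(NL)}\,(A^\delta(\phi,\psi)(t_l,x_n))_{l,n}$ (ordered $(t_1,x_1),(t_1,x_2),\dots,(t_L,x_N)$).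 $\mathbb R^{NL}$ carries the inner product $\langle u,v\rangle_{C_\rho}=u^\top C_\rho v$, $C_\rho=\operatorname{diag}\{\rho_{t_1}(x_1),\dots,\rho_{t_L}(x_N)\}$; $A_{NL}^{\delta*}$ is the adjoint with respect to it and $B_{NL}^\delta=A_{NL}^{\delta*}A_{NL}^\delta$. Data vector. $f_{NL}^\delta=(f^\delta(t_l,x_n))_{l,n}\in\mathbb R^{NL}$ (same ordering), where, for a known internal energy function $U$: for data from the Wasserstein gradient flow $\partial_t\rho_t-\Delta_{\rho_t}U'(\rho_t)=\Delta_{\rho_t}(V+W*\rho_t)$, $$f^\delta(t_l,x_n)=(\delta_t^+\rho)_l^n-(\delta_x^+\rho)_l^n\,\partial_xU'(\rho_l^n)-\rho_l^n\,\partial_{xx}U'(\rho_l^n);$$ for data from the Wasserstein Hamiltonian flow $\partial_{tt}\rho_t+\Gamma_W(\partial_t\rho_t,\partial_t\rho_t)-\Delta_{\rho_t}U'(\rho_t)=\Delta_{\rho_t}(V+W*\rho_t)$, $$f^\delta(t_l,x_n)=(\delta_{tt}^+\rho)_l^n+\Gamma_W((\delta_t^+\rho)_l^n,(\delta_t^+\rho)_l^n)-(\delta_x^+\rho)_l^n\,\partial_xU'(\rho_l^n)-\rho_l^n\,\partial_{xx}U'(\rho_l^n),$$ where $\Gamma_W(\sigma,\sigma)=-\big(\Delta_\sigma\Delta_{\rho_t}^\dagger\sigma+\tfrac12\Delta_{\rho_t}|\nabla\Delta_{\rho_t}^\dagger\sigma|^2\big)$ and $\Delta_{\rho}^\dagger$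 is the pseudo-inverse of $\Delta_\rho$.
   Formalization: Part (2) also assumes that the norms of evaluating ψ, ψ', ψ'' on H_{K_2} at x−z are dominated, for x near Ω, by a ρ_t-integrable function of z (else ψ*ρ_t may not exist), with C^4 on open neighbourhoods; part (1) assumes ρ jointly Borel measurable. *)

theory Defs
  imports "HOL-Analysis.Analysis"
begin

section \<open>Differential calculus on Euclidean space\<close>

definition pd :: "'a::euclidean_space \<Rightarrow> ('a \<Rightarrow> real) \<Rightarrow> 'a \<Rightarrow> real" where
  "pd i f x = deriv (\<lambda>s. f (x + s *\<^sub>R i)) 0"

primrec pds :: "'a::euclidean_space list \<Rightarrow> ('a \<Rightarrow> real) \<Rightarrow> 'a \<Rightarrow> real" where
  "pds [] f = f"
| "pds (i # is) f = pd i (pds is f)"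

text \<open>Lists over \<^term>\<open>Basis\<close> play the role of multi-indices. The second conjunct makes the
  partial derivatives exist, since \<^const>\<open>deriv\<close> is total. Only used for open \<open>S\<close>.\<close>

definition C_k_on :: "nat \<Rightarrow> 'a::euclidean_space set \<Rightarrow> ('a \<Rightarrow> real) \<Rightarrow> bool" where
  "C_k_on k S f \<longleftrightarrow>
     (\<forall>is. set is \<subseteq> Basis \<and> length is \<le> k \<longrightarrow> continuous_on S (pds is f)) \<and>
     (\<forall>is. set is \<subseteq> Basis \<and> length is < k \<longrightarrow>
        (\<forall>i\<in>Basis. \<forall>x\<in>S. (\<lambda>s. pds is f (x + s *\<^sub>R i)) differentiable (at 0)))"

definition Cb_norm :: "nat \<Rightarrow> ('a::euclidean_space \<Rightarrow> real) \<Rightarrow> ennreal" where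
  "Cb_norm k f =
     (SUP is\<in>{is. set is \<subseteq> Basis \<and> length is \<le> k}. SUP x. ennreal \<bar>pds is f x\<bar>)"

definition C_b :: "nat \<Rightarrow> ('a::euclidean_space \<Rightarrow> real) \<Rightarrow> bool" where
  "C_b k f \<longleftrightarrow> C_k_on k UNIV f \<and> Cb_norm k f < \<infinity>"

text \<open>\<open>\<nabla>\<cdot>(\<rho>\<nabla>g)\<close>, with the divergence written out in the standard basis\<close>

definition wlap :: "('a::euclidean_space \<Rightarrow> real) \<Rightarrow> ('a \<Rightarrow> real) \<Rightarrow> 'a \<Rightarrow> real" where
  "wlap rho g x = (\<Sum>i\<in>Basis. pd i (\<lambda>y. rho y * pd i g y) x)"

definition conv :: "('a::euclidean_space \<Rightarrow> real) \<Rightarrow> ('a \<Rightarrow> real) \<Rightarrow> 'a \<Rightarrow> real" where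
  "conv psi rho x = (\<integral>z. psi (x - z) * rho z \<partial>lborel)"


section \<open>Kernels, reproducing kernel Hilbert spaces, densities\<close>

definition mercer_kernel :: "('a::topological_space \<Rightarrow> 'a \<Rightarrow> real) \<Rightarrow> bool" where
  "mercer_kernel K \<longleftrightarrow>
     continuous_on UNIV (\<lambda>(x, y). K x y) \<and>
     (\<forall>x y. K x y = K y x) \<and>
     (\<forall>S c. finite S \<longrightarrow> 0 \<le> (\<Sum>x\<in>S. \<Sum>y\<in>S. c x * c y * K x y))"

text \<open>The Hilbert space is a type \<open>'h\<close>, and \<open>ev h\<close> is the element \<open>h\<close> regarded as a function.
  Since \<open>ev\<close> is linear and injective, \<open>'h\<close> is a Hilbert space of functions; it contains the
  sections of \<open>K\<close> and these reproduce point values. By the Moore-Aronszajn theorem this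
  determines \<open>'h\<close> up to an isometry that respects \<open>ev\<close>.\<close>

definition rkhs ::
  "('a \<Rightarrow> 'a \<Rightarrow> real) \<Rightarrow> ('h::{real_inner, complete_space} \<Rightarrow> 'a \<Rightarrow> real) \<Rightarrow> bool" where
  "rkhs K ev \<longleftrightarrow>
     (\<forall>x. linear (\<lambda>h. ev h x)) \<and> inj ev \<and>
     (\<forall>x. \<exists>k. ev k = K x \<and> (\<forall>h. ev h x = inner h k))"

definition prob_density :: "('a::euclidean_space \<Rightarrow> real) \<Rightarrow> bool" where
  "prob_density rho \<longleftrightarrow> (\<forall>x. 0 \<le> rho x) \<and> has_bochner_integral lborel rho 1"

definition densities :: "nat \<Rightarrow> real \<Rightarrow> (real \<Rightarrow> 'a::euclidean_space \<Rightarrow> real) \<Rightarrow> bool" where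
  "densities k T rho \<longleftrightarrow>
     (\<forall>t\<in>{0..T}. prob_density (rho t) \<and> C_k_on k UNIV (rho t)) \<and>
     (SUP t\<in>{0..T}. Cb_norm k (rho t)) < \<infinity>"


section \<open>Adjoints and Tikhonov regularisation\<close>

text \<open>The codomain is given by its inner product \<open>ip\<close> instead of a type class instance: it is
  either a weighted \<open>L\<^sup>2\<close> space of functions, or a space of grid vectors with a weighted inner
  product.\<close>

definition adjoint_wrt ::
  "('g \<Rightarrow> 'g \<Rightarrow> real) \<Rightarrow> ('h::real_inner \<Rightarrow> 'g) \<Rightarrow> 'g \<Rightarrow> 'h" where
  "adjoint_wrt ip A g = (THE h. \<forall>u. ip (A u) g = inner u h)"

definition lamI ::
  "real \<Rightarrow> real \<Rightarrow> 'h1::real_vector \<times> 'h2::real_vector \<Rightarrow> 'h1 \<times> 'h2" where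
  "lamI lam1 lam2 = (\<lambda>(phi, psi). (lam1 *\<^sub>R phi, lam2 *\<^sub>R psi))"


section \<open>The continuous problem\<close>

definition L2_inner ::
  "real \<Rightarrow> (real \<Rightarrow> 'a::euclidean_space \<Rightarrow> real) \<Rightarrow>
   (real \<Rightarrow> 'a \<Rightarrow> real) \<Rightarrow> (real \<Rightarrow> 'a \<Rightarrow> real) \<Rightarrow> real" where
  "L2_inner T rho g h = (LINT t:{0..T}|lborel. (\<integral>x. g t x * h t x * rho t x \<partial>lborel))"

definition L2_norm ::
  "real \<Rightarrow> (real \<Rightarrow> 'a::euclidean_space \<Rightarrow> real) \<Rightarrow> (real \<Rightarrow> 'a \<Rightarrow> real) \<Rightarrow> real" where
  "L2_norm T rho g = sqrt (L2_inner T rho g g)"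

definition L2_space ::
  "real \<Rightarrow> (real \<Rightarrow> 'a::euclidean_space \<Rightarrow> real) \<Rightarrow> (real \<Rightarrow> 'a \<Rightarrow> real) set" where
  "L2_space T rho =
     {g. set_borel_measurable borel ({0..T} \<times> UNIV) (\<lambda>(t, x). g t x) \<and>
         (\<integral>\<^sup>+t\<in>{0..T}. (\<integral>\<^sup>+x. ennreal (\<bar>g t x\<bar>\<^sup>2 * rho t x) \<partial>lborel) \<partial>lborel) < \<infinity>}"

definition A_op ::
  "(real \<Rightarrow> 'a::euclidean_space \<Rightarrow> real) \<Rightarrow> ('h1 \<Rightarrow> 'a \<Rightarrow> real) \<Rightarrow> ('h2 \<Rightarrow> 'a \<Rightarrow> real) \<Rightarrow>
   'h1 \<times> 'h2 \<Rightarrow> real \<Rightarrow> 'a \<Rightarrow> real" where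
  "A_op rho ev1 ev2 =
     (\<lambda>(phi, psi) t x. wlap (rho t) (\<lambda>y. ev1 phi y + conv (ev2 psi) (rho t) y) x)"

definition B_op ::
  "real \<Rightarrow> (real \<Rightarrow> 'a::euclidean_space \<Rightarrow> real) \<Rightarrow>
   ('h1::real_inner \<Rightarrow> 'a \<Rightarrow> real) \<Rightarrow> ('h2::real_inner \<Rightarrow> 'a \<Rightarrow> real) \<Rightarrow>
   'h1 \<times> 'h2 \<Rightarrow> 'h1 \<times> 'h2" where
  "B_op T rho ev1 ev2 =
     adjoint_wrt (L2_inner T rho) (A_op rho ev1 ev2) \<circ> A_op rho ev1 ev2"

definition R_risk ::
  "real \<Rightarrow> (real \<Rightarrow> 'a::euclidean_space \<Rightarrow> real) \<Rightarrow>
   ('h1::real_normed_vector \<Rightarrow> 'a \<Rightarrow> real) \<Rightarrow> ('h2::real_normed_vector \<Rightarrow> 'a \<Rightarrow> real) \<Rightarrow>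
   'h1 \<times> 'h2 \<Rightarrow> real \<Rightarrow> real \<Rightarrow> 'h1 \<times> 'h2 \<Rightarrow> real" where
  "R_risk T rho ev1 ev2 VW lam1 lam2 = (\<lambda>(phi, psi).
     (L2_norm T rho
        (\<lambda>t x. A_op rho ev1 ev2 (phi, psi) t x - A_op rho ev1 ev2 VW t x))\<^sup>2
     + lam1 * (norm phi)\<^sup>2 + lam2 * (norm psi)\<^sup>2)"

text \<open>The integral formula for \<open>B = A\<^sup>*A\<close>, read at a point \<open>y\<close>\<close>

lemma B_op_formula:
  fixes ev1 :: "'h1::{real_inner, complete_space} \<Rightarrow> 'a::euclidean_space \<Rightarrow> real"
    and ev2 :: "'h2::{real_inner, complete_space} \<Rightarrow> 'a \<Rightarrow> real"
  assumes K: "mercer_kernel K1" "mercer_kernel K2"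
    and H: "rkhs K1 ev1" "rkhs K2 ev2"
    and adj: "\<exists>h. \<forall>u. L2_inner T rho (A_op rho ev1 ev2 u) (A_op rho ev1 ev2 w) = inner u h"
  shows "ev1 (fst (B_op T rho ev1 ev2 w)) y =
           (LINT t:{0..T}|lborel. (\<integral>x. A_op rho ev1 ev2 w t x *
              wlap (rho t) (\<lambda>x. K1 x y) x * rho t x \<partial>lborel))" (is ?th1)
    and "ev2 (snd (B_op T rho ev1 ev2 w)) y =
           (LINT t:{0..T}|lborel. (\<integral>x. A_op rho ev1 ev2 w t x *
              wlap (rho t) (\<lambda>x. \<integral>z. K2 (x - z) y * rho t z \<partial>lborel) x * rho t x \<partial>lborel))" (is ?th2)
proof -
  let ?A = "A_op rho ev1 ev2"
  obtain h where h: "\<And>u. L2_inner T rho (?A u) (?A w) = inner u h"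
    using adj by blast
  have "h' = h" if "\<forall>u. L2_inner T rho (?A u) (?A w) = inner u h'" for h'
    using that h by (metis vector_eq_ldot)
  then have Bh: "B_op T rho ev1 ev2 w = h"
    unfolding B_op_def adjoint_wrt_def comp_def
    by (intro the_equality) (use h in auto)
  obtain k1 where k1: "ev1 k1 = K1 y" "\<And>h. ev1 h y = inner h k1"
    using H(1) unfolding rkhs_def by blast
  obtain k2 where k2: "ev2 k2 = K2 y" "\<And>h. ev2 h y = inner h k2"
    using H(2) unfolding rkhs_def by blast
  have z: "ev1 0 = (\<lambda>_. 0)" "ev2 0 = (\<lambda>_. 0)"
    using H unfolding rkhs_def by (auto dest: linear_0 simp: fun_eq_iff)
  have s: "K1 u v = K1 v u" "K2 u v = K2 v u" for u v
    using K unfolding mercer_kernel_def by auto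
  have a1: "?A (k1, 0) t x = wlap (rho t) (\<lambda>x. K1 x y) x" for t x
    by (simp add: A_op_def k1(1) z conv_def s(1)[of y])
  have a2: "?A (0, k2) t x = wlap (rho t) (\<lambda>x. \<integral>z. K2 (x - z) y * rho t z \<partial>lborel) x" for t x
    by (simp add: A_op_def k2(1) z conv_def s(2)[of y])
  have "ev1 (fst h) y = L2_inner T rho (?A (k1, 0)) (?A w)"
    by (simp add: h k1(2) inner_commute inner_prod_def)
  then show ?th1
    by (simp add: Bh L2_inner_def a1 mult_ac)
  have "ev2 (snd h) y = L2_inner T rho (?A (0, k2)) (?A w)"
    by (simp add: h k2(2) inner_commute inner_prod_def)
  then show ?th2
    by (simp add: Bh L2_inner_def a2 mult_ac)
qed


section \<open>The discrete problem in dimension one\<close>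

definition gx :: "real \<Rightarrow> real \<Rightarrow> nat \<Rightarrow> nat \<Rightarrow> real" where
  "gx a b N n = a + real n * ((b - a) / real N)"

definition gt :: "real \<Rightarrow> nat \<Rightarrow> nat \<Rightarrow> real" where
  "gt T L l = real l * (T / real L)"

text \<open>The time differences are functions of \<open>x\<close>, because \<open>\<Gamma>\<^sub>W\<close> acts on them as such;
  their grid values are obtained at \<open>x = x\<^sub>n\<close>.\<close>

definition dt_fwd :: "real \<Rightarrow> nat \<Rightarrow> (real \<Rightarrow> real \<Rightarrow> real) \<Rightarrow> nat \<Rightarrow> real \<Rightarrow> real" where
  "dt_fwd T L rho l x =
     (if l < L then (rho (gt T L (l + 1)) x - rho (gt T L l) x) / (T / real L)
      else - rho (gt T L l) x / (T / real L))"

definition dtt_fwd :: "real \<Rightarrow> nat \<Rightarrow> (real \<Rightarrow> real \<Rightarrow> real) \<Rightarrow> nat \<Rightarrow> real \<Rightarrow> real" where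
  "dtt_fwd T L rho l x =
     (if l < L then (dt_fwd T L rho (l + 1) x - dt_fwd T L rho l x) / (T / real L)
      else - dt_fwd T L rho l x / (T / real L))"

definition dx_fwd ::
  "real \<Rightarrow> real \<Rightarrow> nat \<Rightarrow> real \<Rightarrow> nat \<Rightarrow> (real \<Rightarrow> real \<Rightarrow> real) \<Rightarrow> nat \<Rightarrow> nat \<Rightarrow> real" where
  "dx_fwd a b N T L rho l n =
     (if n < N then (rho (gt T L l) (gx a b N (n + 1)) - rho (gt T L l) (gx a b N n)) / ((b - a) / real N)
      else - rho (gt T L l) (gx a b N n) / ((b - a) / real N))"

definition A_delta ::
  "real \<Rightarrow> real \<Rightarrow> nat \<Rightarrow> real \<Rightarrow> nat \<Rightarrow> (real \<Rightarrow> real \<Rightarrow> real) \<Rightarrow>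
   ('h1 \<Rightarrow> real \<Rightarrow> real) \<Rightarrow> ('h2 \<Rightarrow> real \<Rightarrow> real) \<Rightarrow> 'h1 \<times> 'h2 \<Rightarrow> nat \<Rightarrow> nat \<Rightarrow> real" where
  "A_delta a b N T L rho ev1 ev2 = (\<lambda>(phi, psi) l n.
     (let g = (\<lambda>x. ev1 phi x + conv (ev2 psi) (rho (gt T L l)) x) in
      dx_fwd a b N T L rho l n * deriv g (gx a b N n) +
      rho (gt T L l) (gx a b N n) * deriv (deriv g) (gx a b N n)))"

text \<open>A vector of \<open>\<real>\<^bsup>NL\<^esup>\<close> is a function of the indices \<open>l\<in>{1..L}\<close> and \<open>n\<in>{1..N}\<close>; the values at
  other indices are never used.\<close>

definition A_NL ::
  "real \<Rightarrow> real \<Rightarrow> nat \<Rightarrow> real \<Rightarrow> nat \<Rightarrow> (real \<Rightarrow> real \<Rightarrow> real) \<Rightarrow>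
   ('h1 \<Rightarrow> real \<Rightarrow> real) \<Rightarrow> ('h2 \<Rightarrow> real \<Rightarrow> real) \<Rightarrow> 'h1 \<times> 'h2 \<Rightarrow> nat \<Rightarrow> nat \<Rightarrow> real" where
  "A_NL a b N T L rho ev1 ev2 u = (\<lambda>l n.
     sqrt (T * (b - a) / (real N * real L)) * A_delta a b N T L rho ev1 ev2 u l n)"

definition inner_C ::
  "real \<Rightarrow> real \<Rightarrow> nat \<Rightarrow> real \<Rightarrow> nat \<Rightarrow> (real \<Rightarrow> real \<Rightarrow> real) \<Rightarrow>
   (nat \<Rightarrow> nat \<Rightarrow> real) \<Rightarrow> (nat \<Rightarrow> nat \<Rightarrow> real) \<Rightarrow> real" where
  "inner_C a b N T L rho u v =
     (\<Sum>l=1..L. \<Sum>n=1..N. u l n * rho (gt T L l) (gx a b N n) * v l n)"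

definition A_NL_adj ::
  "real \<Rightarrow> real \<Rightarrow> nat \<Rightarrow> real \<Rightarrow> nat \<Rightarrow> (real \<Rightarrow> real \<Rightarrow> real) \<Rightarrow>
   ('h1::real_inner \<Rightarrow> real \<Rightarrow> real) \<Rightarrow> ('h2::real_inner \<Rightarrow> real \<Rightarrow> real) \<Rightarrow>
   (nat \<Rightarrow> nat \<Rightarrow> real) \<Rightarrow> 'h1 \<times> 'h2" where
  "A_NL_adj a b N T L rho ev1 ev2 =
     adjoint_wrt (inner_C a b N T L rho) (A_NL a b N T L rho ev1 ev2)"

definition B_NL ::
  "real \<Rightarrow> real \<Rightarrow> nat \<Rightarrow> real \<Rightarrow> nat \<Rightarrow> (real \<Rightarrow> real \<Rightarrow> real) \<Rightarrow>
   ('h1::real_inner \<Rightarrow> real \<Rightarrow> real) \<Rightarrow> ('h2::real_inner \<Rightarrow> real \<Rightarrow> real) \<Rightarrow>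
   'h1 \<times> 'h2 \<Rightarrow> 'h1 \<times> 'h2" where
  "B_NL a b N T L rho ev1 ev2 =
     A_NL_adj a b N T L rho ev1 ev2 \<circ> A_NL a b N T L rho ev1 ev2"

definition R_hat ::
  "real \<Rightarrow> real \<Rightarrow> nat \<Rightarrow> real \<Rightarrow> nat \<Rightarrow> (real \<Rightarrow> real \<Rightarrow> real) \<Rightarrow>
   ('h1::real_normed_vector \<Rightarrow> real \<Rightarrow> real) \<Rightarrow> ('h2::real_normed_vector \<Rightarrow> real \<Rightarrow> real) \<Rightarrow>
   (nat \<Rightarrow> nat \<Rightarrow> real) \<Rightarrow> real \<Rightarrow> real \<Rightarrow> 'h1 \<times> 'h2 \<Rightarrow> real" where
  "R_hat a b N T L rho ev1 ev2 f lam1 lam2 = (\<lambda>(phi, psi).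
     T * (b - a) / (real N * real L) *
       (\<Sum>l=1..L. \<Sum>n=1..N.
          \<bar>A_delta a b N T L rho ev1 ev2 (phi, psi) l n - f l n\<bar>\<^sup>2 * rho (gt T L l) (gx a b N n))
     + lam1 * (norm phi)\<^sup>2 + lam2 * (norm psi)\<^sup>2)"

text \<open>\<open>C\<^sup>4\<close> regularity at the arguments at which the kernels are evaluated, where \<open>\<Omega> = [a,b]\<close>.
  The derivatives at the end point \<open>x\<^sub>N = b\<close> are two-sided, so both kernels are taken \<open>C\<^sup>4\<close>
  on an open neighbourhood: \<open>K\<^sub>1\<close> near \<open>\<Omega> \<times> \<Omega>\<close>, and \<open>K\<^sub>2\<close>, which only occurs through
  \<open>\<psi> * \<rho>\<^sub>t\<close>, near the points \<open>x - z\<close> with \<open>x \<in> \<Omega>\<close> and \<open>\<rho>\<^sub>t(z) \<noteq> 0\<close>.\<close>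

definition near :: "real \<Rightarrow> real \<Rightarrow> real \<Rightarrow> real set" where
  "near a b e = {a - e<..<b + e}"

definition conv_args ::
  "real \<Rightarrow> real \<Rightarrow> real \<Rightarrow> (real \<Rightarrow> real \<Rightarrow> real) \<Rightarrow> real \<Rightarrow> real set" where
  "conv_args a b T rho e =
     {x - z | x z. x \<in> near a b e \<and> (\<exists>t\<in>{0..T}. rho t z \<noteq> 0)}"

text \<open>The norm of the functional \<open>\<psi> \<mapsto> \<psi>\<^sup>(\<^sup>j\<^sup>)(y)\<close> on the RKHS is the square root of
  \<open>(\<partial>\<^sub>1\<^sup>j \<partial>\<^sub>2\<^sup>j K)(y,y)\<close>.\<close>

definition eval_norm :: "(real \<Rightarrow> real \<Rightarrow> real) \<Rightarrow> nat \<Rightarrow> real \<Rightarrow> real" where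
  "eval_norm K j y =
     sqrt (pds (replicate j (1, 0) @ replicate j (0, 1)) (\<lambda>(x, x'). K x x') (y, y))"

text \<open>The last conjunct is the integrability that makes \<open>\<psi> * \<rho>\<^sub>t\<close>, \<open>\<partial>\<^sub>x(\<psi> * \<rho>\<^sub>t)\<close> and
  \<open>\<partial>\<^sub>x\<^sub>x(\<psi> * \<rho>\<^sub>t)\<close> well-defined when \<open>\<rho>\<^sub>t\<close> does not have compact support. It holds with a
  constant \<open>g\<close> if these derivatives of \<open>K\<^sub>2\<close> are bounded, in particular if \<open>K\<^sub>2\<close> is
  \<open>C\<^sup>4\<close> near a compact set of arguments.\<close>

definition kernels_C4 ::
  "real \<Rightarrow> real \<Rightarrow> real \<Rightarrow> (real \<Rightarrow> real \<Rightarrow> real) \<Rightarrow>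
   (real \<Rightarrow> real \<Rightarrow> real) \<Rightarrow> (real \<Rightarrow> real \<Rightarrow> real) \<Rightarrow> bool" where
  "kernels_C4 a b T rho K1 K2 \<longleftrightarrow> (\<exists>e>0.
     C_k_on 4 (near a b e \<times> near a b e) (\<lambda>(x, y). K1 x y) \<and>
     C_k_on 4 (conv_args a b T rho e \<times> conv_args a b T rho e) (\<lambda>(x, y). K2 x y) \<and>
     (\<forall>t\<in>{0..T}. \<exists>g. integrable lborel (\<lambda>z. g z * rho t z) \<and>
        (\<forall>j\<le>2. \<forall>x\<in>near a b e. \<forall>z. rho t z \<noteq> 0 \<longrightarrow> eval_norm K2 j (x - z) \<le> g z)))"


section \<open>Flows and data\<close>

definition fun_subspace :: "('a \<Rightarrow> real) set \<Rightarrow> bool" where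
  "fun_subspace X \<longleftrightarrow> (\<lambda>_. 0) \<in> X \<and> (\<forall>f\<in>X. \<forall>g\<in>X. \<forall>c d. (\<lambda>x. c * f x + d * g x) \<in> X)"

text \<open>\<open>D\<close> is a pseudo-inverse of \<open>F\<close> between a space \<open>X\<close> of potentials and a space \<open>Y\<close> of
  variations of densities. The equations are the two algebraic Penrose equations; no inner
  product that selects one among the reflexive generalised inverses is prescribed.\<close>

definition pseudo_inverse ::
  "('a \<Rightarrow> real) set \<Rightarrow> ('a \<Rightarrow> real) set \<Rightarrow>
   (('a \<Rightarrow> real) \<Rightarrow> 'a \<Rightarrow> real) \<Rightarrow> (('a \<Rightarrow> real) \<Rightarrow> 'a \<Rightarrow> real) \<Rightarrow> bool" where
  "pseudo_inverse X Y F D \<longleftrightarrow>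
     fun_subspace X \<and> fun_subspace Y \<and> F ` X \<subseteq> Y \<and> D ` Y \<subseteq> X \<and>
     (\<forall>s\<in>Y. \<forall>r\<in>Y. \<forall>c d. D (\<lambda>x. c * s x + d * r x) = (\<lambda>x. c * D s x + d * D r x)) \<and>
     (\<forall>g\<in>X. F (D (F g)) = F g) \<and> (\<forall>s\<in>Y. D (F (D s)) = D s)"

text \<open>\<open>\<Gamma>\<^sub>W(\<sigma>,\<sigma>)\<close> at the density \<open>\<rho>\<close>; \<open>D\<close> is the pseudo-inverse of \<open>\<Delta>\<^sub>\<rho>\<close>\<close>

definition Gamma_W ::
  "(('a::euclidean_space \<Rightarrow> real) \<Rightarrow> 'a \<Rightarrow> real) \<Rightarrow> ('a \<Rightarrow> real) \<Rightarrow> ('a \<Rightarrow> real) \<Rightarrow> 'a \<Rightarrow> real" where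
  "Gamma_W D rho s x =
     - (wlap s (D s) x + 1/2 * wlap rho (\<lambda>y. \<Sum>i\<in>Basis. (pd i (D s) y)\<^sup>2) x)"

abbreviation time_deriv :: "(real \<Rightarrow> real \<Rightarrow> real) \<Rightarrow> real \<Rightarrow> real \<Rightarrow> real" where
  "time_deriv rho t x \<equiv> deriv (\<lambda>s. rho s x) t"

text \<open>Only the restriction of the flow to \<open>(0,T) \<times> \<Omega>\<close> enters as a hypothesis.\<close>

definition gradient_flow ::
  "real \<Rightarrow> real \<Rightarrow> real \<Rightarrow> (real \<Rightarrow> real \<Rightarrow> real) \<Rightarrow> (real \<Rightarrow> real) \<Rightarrow>
   (real \<Rightarrow> real) \<Rightarrow> (real \<Rightarrow> real) \<Rightarrow> bool" where
  "gradient_flow a b T rho U V W \<longleftrightarrow>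
     (\<forall>t\<in>{0<..<T}. \<forall>x\<in>{a..b}.
        (\<lambda>s. rho s x) differentiable (at t) \<and>
        time_deriv rho t x - wlap (rho t) (\<lambda>y. deriv U (rho t y)) x =
          wlap (rho t) (\<lambda>y. V y + conv W (rho t) y) x)"

definition hamiltonian_flow ::
  "real \<Rightarrow> real \<Rightarrow> real \<Rightarrow> (real \<Rightarrow> real \<Rightarrow> real) \<Rightarrow> (real \<Rightarrow> real) \<Rightarrow>
   (real \<Rightarrow> (real \<Rightarrow> real) \<Rightarrow> real \<Rightarrow> real) \<Rightarrow> (real \<Rightarrow> real) \<Rightarrow> (real \<Rightarrow> real) \<Rightarrow> bool" where
  "hamiltonian_flow a b T rho U D V W \<longleftrightarrow>
     (\<forall>t\<in>{0<..<T}. \<forall>x\<in>{a..b}.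
        (\<lambda>s. rho s x) differentiable (at t) \<and>
        (\<lambda>s. time_deriv rho s x) differentiable (at t) \<and>
        time_deriv (time_deriv rho) t x + Gamma_W (D t) (rho t) (time_deriv rho t) x
          - wlap (rho t) (\<lambda>y. deriv U (rho t y)) x =
          wlap (rho t) (\<lambda>y. V y + conv W (rho t) y) x)"

definition f_gradient ::
  "real \<Rightarrow> real \<Rightarrow> nat \<Rightarrow> real \<Rightarrow> nat \<Rightarrow> (real \<Rightarrow> real \<Rightarrow> real) \<Rightarrow> (real \<Rightarrow> real) \<Rightarrow>
   nat \<Rightarrow> nat \<Rightarrow> real" where
  "f_gradient a b N T L rho U l n =
     (let x = gx a b N n; r = rho (gt T L l) in
      dt_fwd T L rho l x
      - dx_fwd a b N T L rho l n * deriv (\<lambda>y. deriv U (r y)) x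
      - r x * deriv (deriv (\<lambda>y. deriv U (r y))) x)"

definition f_hamiltonian ::
  "real \<Rightarrow> real \<Rightarrow> nat \<Rightarrow> real \<Rightarrow> nat \<Rightarrow> (real \<Rightarrow> real \<Rightarrow> real) \<Rightarrow> (real \<Rightarrow> real) \<Rightarrow>
   (real \<Rightarrow> (real \<Rightarrow> real) \<Rightarrow> real \<Rightarrow> real) \<Rightarrow> nat \<Rightarrow> nat \<Rightarrow> real" where
  "f_hamiltonian a b N T L rho U D l n =
     (let x = gx a b N n; r = rho (gt T L l) in
      dtt_fwd T L rho l x + Gamma_W (D (gt T L l)) r (dt_fwd T L rho l) x
      - dx_fwd a b N T L rho l n * deriv (\<lambda>y. deriv U (r y)) x
      - r x * deriv (deriv (\<lambda>y. deriv U (r y))) x)"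

text \<open>\<open>D t\<close> stands for the pseudo-inverse of \<open>\<Delta>\<^bsub>\<rho>\<^sub>t\<^esub>\<close>; \<open>Y t\<close> contains every variation to which it is
  applied.\<close>

definition flow_data ::
  "real \<Rightarrow> real \<Rightarrow> nat \<Rightarrow> real \<Rightarrow> nat \<Rightarrow> (real \<Rightarrow> real \<Rightarrow> real) \<Rightarrow> (real \<Rightarrow> real) \<Rightarrow>
   (real \<Rightarrow> real) \<Rightarrow> (real \<Rightarrow> real) \<Rightarrow> (nat \<Rightarrow> nat \<Rightarrow> real) \<Rightarrow> bool" where
  "flow_data a b N T L rho U V W f \<longleftrightarrow>
     (gradient_flow a b T rho U V W \<and> f = f_gradient a b N T L rho U) \<or>
     (\<exists>X Y D.
        (\<forall>t\<in>{0..T}. X t \<subseteq> {g. C_k_on 2 UNIV g} \<and> pseudo_inverse (X t) (Y t) (wlap (rho t)) (D t)) \<and>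
        (\<forall>t\<in>{0<..<T}. time_deriv rho t \<in> Y t) \<and>
        (\<forall>l\<in>{1..L}. dt_fwd T L rho l \<in> Y (gt T L l)) \<and>
        hamiltonian_flow a b T rho U D V W \<and> f = f_hamiltonian a b N T L rho U D)"

end

theory Submission
  imports Defs
begin

text \<open>Both risks have the form \<open>J u = b(u, u) - 2\<langle>u, h\<rangle> + const + \<langle>u, \<lambda>u\<rangle>\<close> on the Hilbert space
  \<open>\<H>\<^sub>1 \<times> \<H>\<^sub>2\<close>, where \<open>b(u, v) = \<langle>Au, Av\<rangle>\<close> and \<open>h\<close> is the adjoint of \<open>A\<close> applied to the data (in
  the discrete problem, to a multiple of \<open>f\<close>). If \<open>b\<close> is bounded, the form \<open>b + \<lambda>\<close> is symmetric
  and coercive, so \<open>B + \<lambda>I\<close> is bijective (\<open>coercive_form_represents\<close>), and completing the square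
  identifies the unique minimiser as \<open>(B + \<lambda>I)\<^sup>-\<^sup>1h\<close> (\<open>regularised_least_squares\<close>). The adjoints
  themselves exist by the same representation result.

  What remains is to show that \<open>A\<close> is well defined and bounded. By the double mean value
  theorem, the feature map \<open>x \<mapsto> K(x, \<cdot>)\<close> of a kernel with a continuous mixed second derivative
  is differentiable along every axis as a map into the Hilbert space
  (\<open>feature_map_differentiable\<close>). Two applications give the derivatives of \<open>h \<in> \<H>\<^sub>K\<close> up to
  second order as inner products \<open>\<langle>h, F j x\<rangle>\<close>, with \<open>\<parallel>F j x\<parallel>\<^sup>2\<close> the diagonal value of
  \<open>\<partial>\<^sub>1\<^sup>j\<partial>\<^sub>2\<^sup>jK\<close> (\<open>rkhs_jet\<close>). Dominated convergence carries these bounds over to \<open>\<psi> * \<rho>\<^sub>t\<close> (the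
  locale \<open>potential_jet\<close>). Pure second derivatives suffice, because \<open>\<nabla>\<cdot>(\<rho>\<nabla>f) = \<Sum>\<^sub>i (\<partial>\<^sub>i\<rho> \<partial>\<^sub>if +
  \<rho> \<partial>\<^sub>i\<^sub>if)\<close>. In the continuous problem \<open>A(\<phi>, \<psi>)\<close> is then bounded in the sup norm
  (\<open>A_op_bounded\<close>), hence in \<open>L\<^sup>2\<close>; in the discrete problem \<open>A\<close> consists of finitely many
  bounded functionals (\<open>bounded_linear_A_delta\<close>).\<close>


section \<open>Quadratic functionals on a Hilbert space\<close>

text \<open>The symmetric case of the Lax-Milgram theorem, proved by minimising \<open>a(v, v) - 2 l(v)\<close>. With
  the inner product as \<open>a\<close> it is the Riesz representation theorem.\<close>

lemma coercive_form_represents: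
  fixes a :: "'h::{real_inner, complete_space} \<Rightarrow> 'h \<Rightarrow> real"
  assumes a: "bounded_bilinear a" and sym: "\<And>u v. a u v = a v u"
    and c: "0 < c" and coercive: "\<And>u. c * (norm u)\<^sup>2 \<le> a u u"
    and l: "bounded_linear l"
  shows "\<exists>u. \<forall>v. a u v = l v"
proof -
  interpret a: bounded_bilinear a by (rule a)
  interpret l: bounded_linear l by (rule l)
  define J where "J v = a v v - 2 * l v" for v
  obtain M where M: "\<And>v. \<bar>l v\<bar> \<le> norm v * M"
    using l.bounded by auto
  have lower: "- (M\<^sup>2 / c) \<le> J v" for v
  proof -
    have "0 \<le> (c * norm v - M)\<^sup>2 / c" using c by simp
    also have "\<dots> = c * (norm v)\<^sup>2 - 2 * (norm v * M) + M\<^sup>2 / c"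
      using c by (simp add: power2_eq_square field_simps)
    also have "\<dots> \<le> J v + M\<^sup>2 / c"
      unfolding J_def using coercive[of v] M[of v] by auto
    finally show ?thesis by simp
  qed
  define m where "m = Inf (range J)"
  have bdd: "bdd_below (range J)" using lower by (auto intro!: bdd_belowI)
  have m_le: "m \<le> J v" for v unfolding m_def by (rule cInf_lower) (use bdd in auto)
  have "\<exists>v. J v < m + inverse (real (Suc n))" for n
  proof -
    have "\<exists>y\<in>range J. y < m + inverse (real (Suc n))"
      using cInf_less_iff[of "range J" "m + inverse (real (Suc n))"] bdd by (simp add: m_def[symmetric])
    then show ?thesis by blast
  qed
  then obtain v where v: "\<And>n. J (v n) < m + inverse (real (Suc n))" by metis
  \<comment> \<open>the parallelogram law for \<open>a\<close> turns near-minimality into the Cauchy property\<close>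
  have par: "a (x - y) (x - y) = 2 * J x + 2 * J y - 4 * J ((1/2) *\<^sub>R (x + y))" for x y
    unfolding J_def
    by (simp add: a.diff_left a.diff_right a.add_left a.add_right a.scaleR_left a.scaleR_right
        l.add l.scaleR sym[of y x] algebra_simps)
  have dist_bound: "c * (norm (v i - v j))\<^sup>2 < 4 * e"
    if "inverse (real (Suc i)) < e" "inverse (real (Suc j)) < e" for i j e
    using coercive[of "v i - v j"] par[of "v i" "v j"] v[of i] v[of j] that
      m_le[of "(1/2) *\<^sub>R (v i + v j)"] by linarith
  have "Cauchy v"
  proof (rule metric_CauchyI)
    fix e :: real assume "0 < e"
    then have "0 < c * e\<^sup>2 / 4" using c by simp
    then obtain n where n: "inverse (real (Suc n)) < c * e\<^sup>2 / 4"
      using reals_Archimedean by blast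
    have "dist (v i) (v j) < e" if "n \<le> i" "n \<le> j" for i j
    proof -
      have "inverse (real (Suc k)) < c * e\<^sup>2 / 4" if "n \<le> k" for k
        by (rule le_less_trans[OF _ n]) (use that in \<open>auto intro!: le_imp_inverse_le\<close>)
      then have "c * (norm (v i - v j))\<^sup>2 < 4 * (c * e\<^sup>2 / 4)"
        by (intro dist_bound) (use that in auto)
      then have "(norm (v i - v j))\<^sup>2 < e\<^sup>2" using c by simp
      then show ?thesis using \<open>0 < e\<close> by (simp add: dist_norm power_less_imp_less_base)
    qed
    then show "\<exists>M. \<forall>i\<ge>M. \<forall>j\<ge>M. dist (v i) (v j) < e" by blast
  qed
  then obtain u where u: "v \<longlonglongrightarrow> u" using Cauchy_convergent convergent_def by blast
  have "(\<lambda>n. J (v n)) \<longlonglongrightarrow> J u"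
    unfolding J_def by (intro tendsto_intros a.tendsto l.tendsto u)
  moreover have "(\<lambda>n. m + inverse (real (Suc n))) \<longlonglongrightarrow> m + 0"
    by (intro tendsto_intros LIMSEQ_inverse_real_of_nat)
  ultimately have "J u \<le> m + 0"
    by (rule LIMSEQ_le) (use v in \<open>auto intro: less_imp_le\<close>)
  then have min: "J u \<le> J w" for w using m_le[of w] by simp
  have "a u w = l w" for w
  proof (rule ccontr)
    assume ne: "a u w \<noteq> l w"
    define d where "d = a u w - l w"
    have quad: "0 \<le> 2 * t * d + t\<^sup>2 * a w w" for t
      using min[of "u + t *\<^sub>R w"] unfolding J_def d_def
      by (simp add: a.add_left a.add_right a.scaleR_left a.scaleR_right l.add l.scaleR
          sym[of w u] power2_eq_square algebra_simps)
    have aw: "0 \<le> a w w"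
      by (rule order_trans[OF _ coercive]) (use c in simp)
    \<comment> \<open>a step \<open>-s d\<close> along \<open>w\<close>, with \<open>s\<close> small, would lower \<open>J\<close> below its minimum\<close>
    define s where "s = 1 / (a w w + 1)"
    have s: "0 < s" "s * a w w < 1" using aw by (auto simp: s_def)
    have "0 \<le> - (s * d\<^sup>2) * (2 - s * a w w)"
      using quad[of "- (s * d)"] by (simp add: power2_eq_square algebra_simps)
    moreover have "0 < (s * d\<^sup>2) * (2 - s * a w w)"
      using s ne by (intro mult_pos_pos) (auto simp: d_def)
    ultimately show False by simp
  qed
  then show ?thesis by blast
qed

lemma inner_adjoint_wrt:
  fixes A :: "'h::{real_inner, complete_space} \<Rightarrow> 'g"
  assumes "bounded_linear (\<lambda>u. ip (A u) g)"
  shows "ip (A u) g = inner u (adjoint_wrt ip A g)"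
proof -
  obtain h where h: "\<And>u. inner h u = ip (A u) g"
    using coercive_form_represents[OF bounded_bilinear_inner inner_commute, of 1, OF _ _ assms]
    by (auto simp: power2_norm_eq_inner)
  have "adjoint_wrt ip A g = h"
    unfolding adjoint_wrt_def
  proof (rule the_equality)
    show "\<forall>u. ip (A u) g = inner u h" using h by (simp add: inner_commute)
    show "h' = h" if "\<forall>u. ip (A u) g = inner u h'" for h'
      using that h by (metis inner_commute vector_eq_ldot)
  qed
  then show ?thesis using h[of u] by (metis inner_commute)
qed

lemma bounded_bilinear_add:
  assumes "bounded_bilinear f" "bounded_bilinear g"
  shows "bounded_bilinear (\<lambda>x y. f x y + g x y)"
proof -
  interpret f: bounded_bilinear f by fact
  interpret g: bounded_bilinear g by fact
  show ?thesis
  proof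
    obtain M N where "\<And>x y. norm (f x y) \<le> norm x * norm y * M"
      and "\<And>x y. norm (g x y) \<le> norm x * norm y * N"
      using f.bounded g.bounded by metis
    then have "norm (f x y + g x y) \<le> norm x * norm y * (M + N)" for x y
      unfolding distrib_left by (intro norm_triangle_le add_mono)
    then show "\<exists>K. \<forall>x y. norm (f x y + g x y) \<le> norm x * norm y * K" by blast
  qed (simp_all add: f.add_left f.add_right f.scaleR_left f.scaleR_right g.add_left g.add_right
      g.scaleR_left g.scaleR_right scaleR_add_right)
qed

lemma bounded_bilinear_sum:
  "(\<And>i. i \<in> I \<Longrightarrow> bounded_bilinear (f i)) \<Longrightarrow> bounded_bilinear (\<lambda>x y. \<Sum>i\<in>I. f i x y)"
proof (induction I rule: infinite_finite_induct)
  case (insert i I)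
  then show ?case by (simp add: bounded_bilinear_add)
qed (simp_all add: bounded_bilinear.intro exI[of _ 0])

text \<open>In both applications \<open>b\<close> is the form \<open>\<langle>Au, Av\<rangle>\<close>, so that \<open>B = A\<^sup>*A\<close>, and \<open>h\<close> stands for \<open>A\<^sup>*g\<close>
  with data \<open>g\<close>. Completing the square around the solution of \<open>(B + \<Lambda>)u = h\<close> shows that this
  solution is the only minimiser.\<close>

lemma regularised_least_squares:
  fixes b :: "'h::{real_inner, complete_space} \<Rightarrow> 'h \<Rightarrow> real"
  assumes b: "bounded_bilinear b" and sym: "\<And>u v. b u v = b v u" and psd: "\<And>u. 0 \<le> b u u"
    and B: "\<And>u v. b u v = inner u (B v)"
    and Lam: "bounded_linear Lam" and Lam_sym: "\<And>u v. inner (Lam u) v = inner u (Lam v)"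
    and c: "0 < c" and coercive: "\<And>u. c * (norm u)\<^sup>2 \<le> inner u (Lam u)"
    and J: "\<And>u. J u = b u u - 2 * inner u h + const + inner u (Lam u)"
  shows "bij (\<lambda>u. B u + Lam u)"
    and "\<exists>!u. is_arg_min J (\<lambda>_. True) u"
    and "is_arg_min J (\<lambda>_. True) u \<Longrightarrow> u = inv (\<lambda>u. B u + Lam u) h"
    and "inv (\<lambda>u. B u + Lam u) (r *\<^sub>R k) = r *\<^sub>R inv (\<lambda>u. B u + Lam u) k"
proof -
  let ?BL = "\<lambda>u. B u + Lam u"
  interpret b: bounded_bilinear b by (rule b)
  interpret Lam: bounded_linear Lam by (rule Lam)
  define a where "a u v = b u v + inner u (Lam v)" for u v
  have a_bil: "bounded_bilinear a"
    unfolding a_def[abs_def]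
    by (intro bounded_bilinear_add b
        bounded_bilinear.comp[OF bounded_bilinear_inner bounded_linear_ident Lam])
  have a_sym: "a u v = a v u" for u v
    unfolding a_def by (metis Lam_sym sym inner_commute)
  have a_coercive: "c * (norm u)\<^sup>2 \<le> a u u" for u
    unfolding a_def using psd[of u] coercive[of u] by simp
  have aBL: "a v u = inner v (?BL u)" for u v
    by (simp add: a_def B inner_add_right)
  interpret a: bounded_bilinear a by (rule a_bil)
  have zero: "u = 0" if "a u u \<le> 0" for u
  proof -
    have "c * (norm u)\<^sup>2 \<le> 0" using a_coercive[of u] that by linarith
    then show ?thesis using c by (simp add: mult_le_0_iff)
  qed
  have "inj ?BL"
  proof (rule injI)
    fix u v assume "?BL u = ?BL v"
    then have "a w u = a w v" for w unfolding aBL by (rule arg_cong)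
    then have "a (u - v) (u - v) = 0" unfolding a.diff_right[of _ u v] by (simp only: diff_self)
    then show "u = v" using zero[of "u - v"] by simp
  qed
  moreover have "\<exists>u. ?BL u = y" for y
  proof -
    obtain u where "\<And>v. a u v = inner y v"
      using coercive_form_represents[OF a_bil a_sym c a_coercive bounded_linear_inner_right] by blast
    then have "\<And>v. inner v (?BL u) = inner v y"
      by (metis aBL a_sym inner_commute)
    then show ?thesis by (metis vector_eq_ldot)
  qed
  ultimately show bij: "bij ?BL" unfolding bij_def surj_def by metis
  have "?BL (r *\<^sub>R inv ?BL k) = r *\<^sub>R k"
  proof (subst vector_eq_ldot[symmetric], rule allI)
    fix v
    have "inner v (?BL (r *\<^sub>R inv ?BL k)) = inner v (r *\<^sub>R ?BL (inv ?BL k))"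
      unfolding inner_scaleR_right aBL[symmetric] by (simp add: a.scaleR_right)
    then show "inner v (?BL (r *\<^sub>R inv ?BL k)) = inner v (r *\<^sub>R k)"
      using bij by (simp add: surj_f_inv_f[of ?BL] bij_is_surj)
  qed
  then show "inv ?BL (r *\<^sub>R k) = r *\<^sub>R inv ?BL k"
    by (rule inv_f_eq[OF bij_is_inj[OF bij]])
  define u0 where "u0 = inv ?BL h"
  have u0: "?BL u0 = h"
    unfolding u0_def by (rule surj_f_inv_f) (use bij in \<open>rule bij_is_surj\<close>)
  have square: "J u = J u0 + a (u - u0) (u - u0)" for u
  proof -
    have "J v = a v v - 2 * a v u0 + const" for v
      unfolding J aBL[of v u0] u0 by (simp add: a_def)
    then show ?thesis
      by (simp add: a.diff_left a.diff_right a_sym[of u0 u])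
  qed
  have "0 \<le> a u u" for u
    by (rule order_trans[OF _ a_coercive]) (use c in simp)
  then have min: "is_arg_min J (\<lambda>_. True) u0"
    unfolding is_arg_min_def by (metis square not_less le_add_same_cancel1)
  show uniq: "u = inv ?BL h" if "is_arg_min J (\<lambda>_. True) u" for u
  proof -
    have "J u \<le> J u0" using that unfolding is_arg_min_def by (simp add: not_less)
    then have "u - u0 = 0" by (intro zero) (use square[of u] in linarith)
    then show ?thesis by (simp add: u0_def)
  qed
  then show "\<exists>!u. is_arg_min J (\<lambda>_. True) u"
    using min by blast
qed

lemma bounded_linear_lamI:
  "bounded_linear (lamI lam1 lam2 :: 'h1::real_normed_vector \<times> 'h2::real_normed_vector \<Rightarrow> _)"
proof -
  have "lamI lam1 lam2 = (\<lambda>u :: 'h1 \<times> 'h2. (lam1 *\<^sub>R fst u, lam2 *\<^sub>R snd u))"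
    by (auto simp: lamI_def)
  then show ?thesis
    by (auto intro!: bounded_linear_Pair bounded_linear_const_scaleR bounded_linear_fst
        bounded_linear_snd)
qed

lemma inner_lamI:
  "inner u (lamI lam1 lam2 v) = lam1 * inner (fst u) (fst v) + lam2 * inner (snd u) (snd v)"
  by (cases v) (simp add: lamI_def inner_prod_def)

lemma lamI_symmetric: "inner (lamI lam1 lam2 u) v = inner u (lamI lam1 lam2 v)"
  by (simp add: inner_lamI inner_commute[of "lamI lam1 lam2 u"]) (simp add: inner_commute)

lemma lamI_coercive: "min lam1 lam2 * (norm u)\<^sup>2 \<le> inner u (lamI lam1 lam2 u)"
proof -
  have "min lam1 lam2 * (norm u)\<^sup>2 = min lam1 lam2 * (norm (fst u))\<^sup>2 + min lam1 lam2 * (norm (snd u))\<^sup>2"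
    by (cases u) (simp add: norm_Pair algebra_simps)
  also have "\<dots> \<le> lam1 * (norm (fst u))\<^sup>2 + lam2 * (norm (snd u))\<^sup>2"
    by (intro add_mono mult_right_mono) auto
  finally show ?thesis by (simp add: inner_lamI power2_norm_eq_inner)
qed


section \<open>Directional derivatives\<close>

text \<open>The derivative of \<open>f\<close> at \<open>x\<close> in the direction \<open>i\<close>; unlike \<^const>\<open>pd\<close> it is
  relational and admits vector values.\<close>

definition has_dir_deriv ::
  "'a::real_normed_vector \<Rightarrow> ('a \<Rightarrow> 'b::real_normed_vector) \<Rightarrow> 'a \<Rightarrow> 'b \<Rightarrow> bool" where
  "has_dir_deriv i f x D \<longleftrightarrow> ((\<lambda>s. f (x + s *\<^sub>R i)) has_vector_derivative D) (at 0)"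

lemma has_dir_deriv_real:
  fixes f :: "'a::real_normed_vector \<Rightarrow> real"
  shows "has_dir_deriv i f x D \<longleftrightarrow> ((\<lambda>s. f (x + s *\<^sub>R i)) has_real_derivative D) (at 0)"
  by (simp add: has_dir_deriv_def has_real_derivative_iff_has_vector_derivative)

lemma pd_eqI: "has_dir_deriv i f x D \<Longrightarrow> pd i f x = D"
  unfolding has_dir_deriv_real pd_def by (rule DERIV_imp_deriv)

lemma has_dir_deriv_unique:
  "has_dir_deriv i f x D \<Longrightarrow> has_dir_deriv i f x E \<Longrightarrow> D = E"
  unfolding has_dir_deriv_def by (rule vector_derivative_unique_at)

lemma has_dir_deriv_along:
  assumes "has_dir_deriv i f (x + r *\<^sub>R i) D"
  shows "((\<lambda>s. f (x + s *\<^sub>R i)) has_vector_derivative D) (at r)"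
proof -
  have "((\<lambda>s. s - r) has_vector_derivative 1) (at r)"
    by (auto intro!: derivative_eq_intros)
  from vector_diff_chain_at[OF this, of "\<lambda>s. f (x + r *\<^sub>R i + s *\<^sub>R i)" D] assms
  show ?thesis
    by (simp add: has_dir_deriv_def o_def algebra_simps)
qed

lemma has_dir_deriv_one:
  fixes f :: "real \<Rightarrow> real"
  shows "has_dir_deriv 1 f x D \<longleftrightarrow> (f has_real_derivative D) (at x)"
  using DERIV_shift[of f D 0 x] by (simp add: has_dir_deriv_real add.commute)

lemma has_dir_deriv_bounded_linear:
  assumes "bounded_linear h" "has_dir_deriv i f x D"
  shows "has_dir_deriv i (\<lambda>x. h (f x)) x (h D)"
  using assms unfolding has_dir_deriv_def by (rule bounded_linear.has_vector_derivative)

lemma has_dir_deriv_inner_right: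
  "has_dir_deriv i f x D \<Longrightarrow> has_dir_deriv i (\<lambda>x. inner h (f x)) x (inner h D)"
  by (rule has_dir_deriv_bounded_linear[OF bounded_linear_inner_right])

lemma has_dir_deriv_inner_left:
  "has_dir_deriv i f x D \<Longrightarrow> has_dir_deriv i (\<lambda>x. inner (f x) h) x (inner D h)"
  by (rule has_dir_deriv_bounded_linear[OF bounded_linear_inner_left])

lemma has_dir_deriv_add:
  "has_dir_deriv i f x D \<Longrightarrow> has_dir_deriv i g x E \<Longrightarrow> has_dir_deriv i (\<lambda>x. f x + g x) x (D + E)"
  unfolding has_dir_deriv_def by (rule has_vector_derivative_add)

lemma has_dir_deriv_mult:
  fixes f g :: "'a::real_normed_vector \<Rightarrow> real"
  assumes "has_dir_deriv i f x D" "has_dir_deriv i g x E"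
  shows "has_dir_deriv i (\<lambda>x. f x * g x) x (D * g x + f x * E)"
  using DERIV_mult[OF assms[unfolded has_dir_deriv_real]]
  by (simp add: has_dir_deriv_real algebra_simps)

lemma eventually_on_line:
  fixes x i :: "'a::real_normed_vector"
  assumes "open S" "x \<in> S"
  shows "eventually (\<lambda>s. x + s *\<^sub>R i \<in> S) (nhds (0::real))"
proof -
  have "((\<lambda>s. x + s *\<^sub>R i) \<longlongrightarrow> x + 0 *\<^sub>R i) (nhds 0)"
    by (intro tendsto_intros filterlim_ident)
  then show ?thesis using topological_tendstoD[OF _ assms(1)] assms(2) by force
qed

lemma has_dir_deriv_cong:
  assumes "open S" "x \<in> S" "\<And>y. y \<in> S \<Longrightarrow> f y = g y" "has_dir_deriv i f x D"
  shows "has_dir_deriv i g x D"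
proof -
  have "eventually (\<lambda>s. f (x + s *\<^sub>R i) = g (x + s *\<^sub>R i)) (nhds 0)"
    using eventually_on_line[OF assms(1,2)] by eventually_elim (use assms(3) in auto)
  then show ?thesis
    using has_vector_derivative_cong_ev[where f = "\<lambda>s. f (x + s *\<^sub>R i)"
        and g = "\<lambda>s. g (x + s *\<^sub>R i)" and x = 0 and S = UNIV and f' = D]
      assms(4) assms(2,3) unfolding has_dir_deriv_def by simp
qed

lemma dir_mvt:
  fixes f :: "'a::real_normed_vector \<Rightarrow> real"
  assumes "\<And>u. 0 \<le> u \<Longrightarrow> u \<le> 1 \<Longrightarrow> has_dir_deriv i f (x + (u * s) *\<^sub>R i) (f' (x + (u * s) *\<^sub>R i))"
  shows "\<exists>u. 0 < u \<and> u < 1 \<and> f (x + s *\<^sub>R i) - f x = s * f' (x + (u * s) *\<^sub>R i)"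
proof -
  have "((\<lambda>u. f (x + (u * s) *\<^sub>R i)) has_real_derivative f' (x + (u * s) *\<^sub>R i) * s) (at u)"
    if "0 \<le> u" "u \<le> 1" for u
  proof -
    have "((\<lambda>r. f (x + r *\<^sub>R i)) has_real_derivative f' (x + (u * s) *\<^sub>R i)) (at (u * s))"
      using has_dir_deriv_along[OF assms[OF that]]
      by (simp add: has_real_derivative_iff_has_vector_derivative)
    moreover have "((\<lambda>u. u * s) has_real_derivative s) (at u)"
      by (auto intro!: derivative_eq_intros)
    ultimately show ?thesis by (rule DERIV_chain2)
  qed
  from MVT2[OF _ this, of 0 1] obtain u where "0 < u" "u < 1"
    "f (x + s *\<^sub>R i) - f x = f' (x + (u * s) *\<^sub>R i) * s" by force
  then show ?thesis by (metis mult.commute)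
qed

text \<open>A derivative is a limit of difference quotients along a fixed sequence.\<close>

lemma borel_measurable_dir_deriv:
  fixes q :: "real \<Rightarrow> 'z \<Rightarrow> real"
  assumes meas: "\<And>s. q s \<in> borel_measurable M"
    and deriv: "\<And>z. z \<in> space M \<Longrightarrow> ((\<lambda>s. q s z) has_real_derivative D z) (at 0)"
  shows "D \<in> borel_measurable M"
proof (rule borel_measurable_LIMSEQ_real)
  let ?r = "\<lambda>n. inverse (real (Suc n))"
  show "(\<lambda>z. (q (?r n) z - q 0 z) / ?r n) \<in> borel_measurable M" for n
    using meas by measurable
  fix z assume "z \<in> space M"
  from deriv[OF this] have "((\<lambda>s. (q s z - q 0 z) / s) \<longlongrightarrow> D z) (at 0)"
    by (simp add: has_field_derivative_iff)
  moreover have "filterlim ?r (at 0) sequentially"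
    by (intro filterlim_atI LIMSEQ_inverse_real_of_nat) auto
  ultimately show "(\<lambda>n. (q (?r n) z - q 0 z) / ?r n) \<longlonglongrightarrow> D z"
    by (rule filterlim_compose)
qed


section \<open>Differentiability of feature maps\<close>

lemma mixed_difference:
  fixes G :: "'a::real_normed_vector \<Rightarrow> 'a \<Rightarrow> real"
  assumes G1: "\<And>x y. x \<in> S \<Longrightarrow> y \<in> S \<Longrightarrow> has_dir_deriv i (\<lambda>x. G x y) x (G1 x y)"
    and G12: "\<And>x y. x \<in> S \<Longrightarrow> y \<in> S \<Longrightarrow> has_dir_deriv i (G1 x) y (G12 x y)"
    and ball: "ball x d \<subseteq> S" and s: "\<bar>s\<bar> * norm i < d" and r: "\<bar>r\<bar> * norm i < d"
  shows "\<exists>p\<in>ball x d. \<exists>q\<in>ball x d.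
    G (x + s *\<^sub>R i) (x + r *\<^sub>R i) - G (x + s *\<^sub>R i) x - G x (x + r *\<^sub>R i) + G x x = s * r * G12 p q"
proof -
  have in_ball: "x + (u * t) *\<^sub>R i \<in> ball x d" if "0 \<le> u" "u \<le> 1" "\<bar>t\<bar> * norm i < d" for u t
  proof -
    have "\<bar>u\<bar> * (\<bar>t\<bar> * norm i) \<le> 1 * (\<bar>t\<bar> * norm i)" using that by (intro mult_right_mono) auto
    then show ?thesis using that by (simp add: dist_norm abs_mult mult_ac)
  qed
  have in_S: "x + (u * t) *\<^sub>R i \<in> S" if "0 \<le> u" "u \<le> 1" "\<bar>t\<bar> * norm i < d" for u t
    using in_ball[OF that] ball by auto
  have ends: "x \<in> S" "x + r *\<^sub>R i \<in> S" using in_S[of 0 s] in_S[of 1 r] s r by auto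
  have "\<exists>u. 0 < u \<and> u < 1 \<and>
    (G (x + s *\<^sub>R i) (x + r *\<^sub>R i) - G (x + s *\<^sub>R i) x) - (G x (x + r *\<^sub>R i) - G x x) =
      s * (G1 (x + (u * s) *\<^sub>R i) (x + r *\<^sub>R i) - G1 (x + (u * s) *\<^sub>R i) x)"
  proof (rule dir_mvt[where f = "\<lambda>p. G p (x + r *\<^sub>R i) - G p x" and f' = "\<lambda>p. G1 p (x + r *\<^sub>R i) - G1 p x"])
    fix u :: real assume "0 \<le> u" "u \<le> 1"
    then have "x + (u * s) *\<^sub>R i \<in> S" using in_S s by blast
    then show "has_dir_deriv i (\<lambda>p. G p (x + r *\<^sub>R i) - G p x) (x + (u * s) *\<^sub>R i)
       (G1 (x + (u * s) *\<^sub>R i) (x + r *\<^sub>R i) - G1 (x + (u * s) *\<^sub>R i) x)"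
      using G1 ends unfolding has_dir_deriv_def by (intro has_vector_derivative_diff) auto
  qed
  then obtain u where u: "0 < u" "u < 1" and eq1:
    "(G (x + s *\<^sub>R i) (x + r *\<^sub>R i) - G (x + s *\<^sub>R i) x) - (G x (x + r *\<^sub>R i) - G x x) =
      s * (G1 (x + (u * s) *\<^sub>R i) (x + r *\<^sub>R i) - G1 (x + (u * s) *\<^sub>R i) x)" by blast
  define p where "p = x + (u * s) *\<^sub>R i"
  have p: "p \<in> ball x d" unfolding p_def by (rule in_ball) (use u s in auto)
  have "\<exists>v. 0 < v \<and> v < 1 \<and> G1 p (x + r *\<^sub>R i) - G1 p x = r * G12 p (x + (v * r) *\<^sub>R i)"
    by (rule dir_mvt) (use G12 p ball in_S r in auto)
  then obtain v where v: "0 < v" "v < 1" "G1 p (x + r *\<^sub>R i) - G1 p x = r * G12 p (x + (v * r) *\<^sub>R i)"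
    by blast
  have q: "x + (v * r) *\<^sub>R i \<in> ball x d" by (rule in_ball) (use v r in auto)
  have "G (x + s *\<^sub>R i) (x + r *\<^sub>R i) - G (x + s *\<^sub>R i) x - G x (x + r *\<^sub>R i) + G x x
      = s * r * G12 p (x + (v * r) *\<^sub>R i)"
    using eq1 v(3) by (simp add: p_def algebra_simps)
  then show ?thesis using p q by blast
qed

text \<open>By the double mean value theorem the inner product of the difference quotients of \<open>F\<close>
  for the increments \<open>s\<close> and \<open>r\<close> is a value of \<open>G12\<close> near \<open>(x, x)\<close>. Hence these
  quotients form a Cauchy filter.\<close>

lemma feature_map_differentiable:
  fixes F :: "'a::real_normed_vector \<Rightarrow> 'h::{real_inner, complete_space}"
  assumes S: "open S"
    and G1: "\<And>x y. x \<in> S \<Longrightarrow> y \<in> S \<Longrightarrow> has_dir_deriv i (\<lambda>x. inner (F x) (F y)) x (G1 x y)"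
    and G12: "\<And>x y. x \<in> S \<Longrightarrow> y \<in> S \<Longrightarrow> has_dir_deriv i (G1 x) y (G12 x y)"
    and cont: "continuous_on (S \<times> S) (\<lambda>(x, y). G12 x y)"
  shows "\<exists>F'. (\<forall>x\<in>S. has_dir_deriv i F x (F' x)) \<and> (\<forall>x\<in>S. \<forall>y\<in>S. inner (F' x) (F' y) = G12 x y)"
proof -
  have ex: "\<exists>D. has_dir_deriv i F x D" if x: "x \<in> S" for x
  proof -
    define Q where "Q s = (1 / s) *\<^sub>R (F (x + s *\<^sub>R i) - F x)" for s
    have "\<exists>P. eventually P (at 0) \<and> (\<forall>s r. P s \<and> P r \<longrightarrow> dist (Q s) (Q r) < e)" if e: "0 < e" for e
    proof -
      define e' where "e' = e\<^sup>2 / 8"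
      have e': "0 < e'" "4 * e' < e\<^sup>2" using e by (auto simp: e'_def)
      have "isCont (\<lambda>(x, y). G12 x y) (x, x)"
        using cont S x by (simp add: continuous_on_eq_continuous_at open_Times)
      then obtain d0 where d0: "0 < d0" "\<And>z. dist z (x, x) < d0 \<Longrightarrow> dist (case z of (x, y) \<Rightarrow> G12 x y) (G12 x x) < e'"
        using e' unfolding continuous_at_eps_delta by force
      obtain d1 where d1: "0 < d1" "ball x d1 \<subseteq> S" using S x open_contains_ball by blast
      define d where "d = min d1 (d0 / 2)"
      have d: "0 < d" "ball x d \<subseteq> S" using d0 d1 by (auto simp: d_def)
      have near: "\<bar>G12 p q - G12 x x\<bar> < e'" if "p \<in> ball x d" "q \<in> ball x d" for p q
      proof -
        have "dist (p, q) (x, x) \<le> dist p x + dist q x"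
          unfolding dist_Pair_Pair by (rule sqrt_sum_squares_le_sum) auto
        also have "\<dots> < d0" using that by (simp add: d_def dist_commute)
        finally show ?thesis using d0(2)[of "(p, q)"] by (simp add: dist_real_def)
      qed
      define P where "P s \<longleftrightarrow> s \<noteq> 0 \<and> \<bar>s\<bar> * norm i < d" for s :: real
      have QQ: "\<bar>inner (Q s) (Q r) - G12 x x\<bar> < e'" if P: "P s" "P r" for s r
      proof -
        obtain p q where pq: "p \<in> ball x d" "q \<in> ball x d"
          "inner (F (x + s *\<^sub>R i)) (F (x + r *\<^sub>R i)) - inner (F (x + s *\<^sub>R i)) (F x)
            - inner (F x) (F (x + r *\<^sub>R i)) + inner (F x) (F x) = s * r * G12 p q"
        proof -
          have "\<bar>s\<bar> * norm i < d" "\<bar>r\<bar> * norm i < d" using P by (auto simp: P_def)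
          from mixed_difference[of S i "\<lambda>x y. inner (F x) (F y)" G1 G12, OF _ _ d(2) this]
          show ?thesis using G1 G12 that by blast
        qed
        have "inner (Q s) (Q r) = (1 / (s * r)) * (inner (F (x + s *\<^sub>R i)) (F (x + r *\<^sub>R i))
            - inner (F (x + s *\<^sub>R i)) (F x) - inner (F x) (F (x + r *\<^sub>R i)) + inner (F x) (F x))"
          unfolding Q_def by (simp add: inner_diff_left inner_diff_right algebra_simps)
        also have "\<dots> = G12 p q" unfolding pq(3) using P by (simp add: P_def)
        finally show ?thesis using near[OF pq(1,2)] by simp
      qed
      have "dist (Q s) (Q r) < e" if "P s" "P r" for s r
      proof -
        have "(dist (Q s) (Q r))\<^sup>2 = inner (Q s) (Q s) - 2 * inner (Q s) (Q r) + inner (Q r) (Q r)"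
          unfolding dist_norm power2_norm_eq_inner
          by (simp add: inner_diff_left inner_diff_right inner_commute)
        also have "\<dots> < e\<^sup>2"
          using QQ[OF that] QQ[OF that(1) that(1)] QQ[OF that(2) that(2)] e' unfolding abs_less_iff by linarith
        finally show ?thesis using e by (simp add: power_less_imp_less_base)
      qed
      moreover have "eventually P (at 0)"
      proof -
        have "((\<lambda>s. \<bar>s\<bar> * norm i) \<longlongrightarrow> \<bar>0\<bar> * norm i) (at (0::real))" by (intro tendsto_intros)
        then have "eventually (\<lambda>s. \<bar>s\<bar> * norm i < d) (at 0)" using d by (intro order_tendstoD) auto
        then show ?thesis
          unfolding P_def using eventually_neq_at_within[of 0 0 UNIV] by eventually_elim auto
      qed
      ultimately show ?thesis by blast
    qed
    then have "cauchy_filter (filtermap Q (at 0))"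
      by (simp add: cauchy_filter_metric_filtermap)
    then obtain D where "(Q \<longlongrightarrow> D) (at 0)"
      using cauchy_filter_complete_converges[OF _ complete_UNIV]
      by (metis filterlim_def filtermap_bot_iff principal_UNIV top_greatest at_neq_bot)
    then have lim: "((\<lambda>s. norm (Q s - D)) \<longlongrightarrow> 0) (at 0)"
      using LIM_zero tendsto_norm_zero by blast
    have "norm (Q s - D) = norm (F (x + s *\<^sub>R i) - F (x + 0 *\<^sub>R i) - (s - 0) *\<^sub>R D) / norm (s - 0)"
      if "s \<noteq> 0" for s
    proof -
      have "F (x + s *\<^sub>R i) - F (x + 0 *\<^sub>R i) - (s - 0) *\<^sub>R D = s *\<^sub>R (Q s - D)"
        using that by (simp add: Q_def algebra_simps)
      then show ?thesis using that by simp
    qed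
    then have "eventually (\<lambda>s. norm (Q s - D) =
        norm (F (x + s *\<^sub>R i) - F (x + 0 *\<^sub>R i) - (s - 0) *\<^sub>R D) / norm (s - 0)) (at 0)"
      unfolding eventually_at_filter by (intro always_eventually) blast
    with lim have "((\<lambda>s. norm (F (x + s *\<^sub>R i) - F (x + 0 *\<^sub>R i) - (s - 0) *\<^sub>R D) / norm (s - 0)) \<longlongrightarrow> 0) (at 0)"
      by (rule Lim_transform_eventually)
    then have "has_dir_deriv i F x D"
      unfolding has_dir_deriv_def has_vector_derivative_def has_derivative_iff_norm
      by (simp add: bounded_linear_scaleR_left)
    then show ?thesis ..
  qed
  then obtain F' where F': "\<And>x. x \<in> S \<Longrightarrow> has_dir_deriv i F x (F' x)" by metis
  have F'F: "inner (F' x) (F y) = G1 x y" if "x \<in> S" "y \<in> S" for x y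
    using has_dir_deriv_inner_left[OF F'] G1 has_dir_deriv_unique that by blast
  have "inner (F' x) (F' y) = G12 x y" if "x \<in> S" "y \<in> S" for x y
  proof -
    have "has_dir_deriv i (G1 x) y (inner (F' x) (F' y))"
      by (rule has_dir_deriv_cong[OF S \<open>y \<in> S\<close> _ has_dir_deriv_inner_right[OF F'[OF \<open>y \<in> S\<close>]]])
        (simp add: F'F that)
    then show ?thesis using G12 that has_dir_deriv_unique by blast
  qed
  then show ?thesis using F' by blast
qed


text \<open>\<open>F j\<close> is the \<open>j\<close>-th derivative of \<open>F 0\<close> in the direction \<open>i\<close> on \<open>S\<close>, for
  \<open>j \<le> k\<close>.\<close>

definition dir_jet ::
  "'a::real_normed_vector \<Rightarrow> 'a set \<Rightarrow> nat \<Rightarrow> (nat \<Rightarrow> 'a \<Rightarrow> 'b::real_normed_vector) \<Rightarrow> bool" where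
  "dir_jet i S k F \<longleftrightarrow> (\<forall>j<k. \<forall>x\<in>S. has_dir_deriv i (F j) x (F (Suc j) x))"

lemma C_k_on_dir_deriv:
  assumes "C_k_on k S f" "set js \<subseteq> Basis" "length js < k" "i \<in> Basis" "x \<in> S"
  shows "has_dir_deriv i (pds js f) x (pds (i # js) f x)"
  using assms unfolding C_k_on_def has_dir_deriv_real
  by (simp add: pd_def DERIV_deriv_iff_real_differentiable)

lemma C_k_on_continuous:
  "C_k_on k S f \<Longrightarrow> set js \<subseteq> Basis \<Longrightarrow> length js \<le> k \<Longrightarrow> continuous_on S (pds js f)"
  unfolding C_k_on_def by blast

lemma has_dir_deriv_Pair:
  "has_dir_deriv (i, 0) f (x, y) D \<longleftrightarrow> has_dir_deriv i (\<lambda>x. f (x, y)) x D"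
  "has_dir_deriv (0, i) f (x, y) D \<longleftrightarrow> has_dir_deriv i (\<lambda>y. f (x, y)) y D"
  by (simp_all add: has_dir_deriv_def)

lemma feature_map_derivative:
  fixes F :: "'a::euclidean_space \<Rightarrow> 'h::{real_inner, complete_space}"
  assumes S: "open S" and i: "i \<in> Basis" and K: "C_k_on n (S \<times> S) K"
    and js: "set js \<subseteq> Basis" "length js + 2 \<le> n"
    and F: "\<And>x y. x \<in> S \<Longrightarrow> y \<in> S \<Longrightarrow> inner (F x) (F y) = pds js K (x, y)"
  shows "\<exists>F'. (\<forall>x\<in>S. has_dir_deriv i F x (F' x)) \<and>
    (\<forall>x\<in>S. \<forall>y\<in>S. inner (F' x) (F' y) = pds ((0, i) # (i, 0) # js) K (x, y))"
proof (rule feature_map_differentiable[OF S])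
  have B: "(i, 0) \<in> Basis" "(0, i) \<in> Basis" using i by (auto simp: Basis_prod_def)
  fix x y assume xy: "x \<in> S" "y \<in> S"
  have "has_dir_deriv i (\<lambda>x. pds js K (x, y)) x (pds ((i, 0) # js) K (x, y))"
    using C_k_on_dir_deriv[OF K js(1) _ B(1), of "(x, y)"] xy js(2) by (simp add: has_dir_deriv_Pair)
  then show "has_dir_deriv i (\<lambda>x. inner (F x) (F y)) x (pds ((i, 0) # js) K (x, y))"
    by (rule has_dir_deriv_cong[OF S xy(1), rotated]) (simp add: F xy)
  show "has_dir_deriv i (\<lambda>y. pds ((i, 0) # js) K (x, y)) y (pds ((0, i) # (i, 0) # js) K (x, y))"
    using C_k_on_dir_deriv[OF K _ _ B(2), of "(i, 0) # js" "(x, y)"] xy B js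
    by (simp add: has_dir_deriv_Pair)
next
  have "(i, 0) \<in> Basis" "(0, i) \<in> Basis" using i by (auto simp: Basis_prod_def)
  then have "continuous_on (S \<times> S) (pds ((0, i) # (i, 0) # js) K)"
    by (intro C_k_on_continuous[OF K]) (use js in auto)
  then show "continuous_on (S \<times> S) (\<lambda>(x, y). pds ((0, i) # (i, 0) # js) K (x, y))"
    by (simp add: case_prod_unfold)
qed

lemma feature_map_jet:
  fixes F0 :: "'a::euclidean_space \<Rightarrow> 'h::{real_inner, complete_space}"
  assumes S: "open S" and i: "i \<in> Basis" and K: "C_k_on n (S \<times> S) K"
    and F0: "\<And>x y. x \<in> S \<Longrightarrow> y \<in> S \<Longrightarrow> inner (F0 x) (F0 y) = K (x, y)"
  assumes "2 * k \<le> n"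
  shows "\<exists>F. F 0 = F0 \<and> dir_jet i S k F"
proof -
  have "\<exists>F js. F 0 = F0 \<and> dir_jet i S k F \<and> set js \<subseteq> Basis \<and> length js = 2 * k \<and>
      (\<forall>x\<in>S. \<forall>y\<in>S. inner (F k x) (F k y) = pds js K (x, y))"
    using \<open>2 * k \<le> n\<close>
  proof (induction k)
    case 0
    show ?case
      by (rule exI[of _ "\<lambda>_. F0"], rule exI[of _ "[]"]) (simp add: F0 dir_jet_def)
  next
    case (Suc k)
    then obtain F js where F: "F 0 = F0" "dir_jet i S k F" "set js \<subseteq> Basis" "length js = 2 * k"
      "\<And>x y. x \<in> S \<Longrightarrow> y \<in> S \<Longrightarrow> inner (F k x) (F k y) = pds js K (x, y)" by auto
    obtain F' where F': "\<And>x. x \<in> S \<Longrightarrow> has_dir_deriv i (F k) x (F' x)"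
      "\<And>x y. x \<in> S \<Longrightarrow> y \<in> S \<Longrightarrow> inner (F' x) (F' y) = pds ((0, i) # (i, 0) # js) K (x, y)"
      using feature_map_derivative[OF S i K F(3) _ F(5)] F(4) Suc.prems by auto
    have "dir_jet i S (Suc k) (F(Suc k := F'))"
      using F(2) F'(1) by (auto simp: dir_jet_def less_Suc_eq)
    then show ?case
      using F F'(2) i
      by (intro exI[of _ "F(Suc k := F')"] exI[of _ "(0, i) # (i, 0) # js"])
        (auto simp: Basis_prod_def simp del: fun_upd_apply, auto)
  qed
  then show ?thesis by blast
qed

text \<open>Once the feature map is differentiable, the mixed derivatives of the kernel can be taken in any
  order; here the derivatives in the second variable are taken first.\<close>

lemma pds_inner_jet:
  fixes F :: "nat \<Rightarrow> 'a::euclidean_space \<Rightarrow> 'h::real_inner"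
  assumes S: "open S" and F: "dir_jet i S k F"
    and K: "\<And>x y. x \<in> S \<Longrightarrow> y \<in> S \<Longrightarrow> inner (F 0 x) (F 0 y) = K (x, y)"
  shows "m \<le> k \<Longrightarrow> n \<le> k \<Longrightarrow> x \<in> S \<Longrightarrow> y \<in> S \<Longrightarrow>
    pds (replicate m (i, 0) @ replicate n (0, i)) K (x, y) = inner (F m x) (F n y)"
proof (induction m arbitrary: x y)
  case 0
  from \<open>n \<le> k\<close> \<open>x \<in> S\<close> \<open>y \<in> S\<close> have "pds (replicate n (0, i)) K (x, y) = inner (F 0 x) (F n y)"
  proof (induction n arbitrary: x y)
    case (Suc n)
    have "has_dir_deriv i (\<lambda>y. inner (F 0 x) (F n y)) y (inner (F 0 x) (F (Suc n) y))"
      by (rule has_dir_deriv_inner_right) (use F Suc.prems in \<open>auto simp: dir_jet_def\<close>)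
    then have "has_dir_deriv i (\<lambda>y. pds (replicate n (0, i)) K (x, y)) y (inner (F 0 x) (F (Suc n) y))"
      by (rule has_dir_deriv_cong[OF S \<open>y \<in> S\<close>, rotated]) (use Suc in auto)
    then show ?case by (simp add: pd_eqI has_dir_deriv_Pair)
  qed (simp add: K)
  then show ?case by simp
next
  case (Suc m)
  have "has_dir_deriv i (\<lambda>x. inner (F m x) (F n y)) x (inner (F (Suc m) x) (F n y))"
    by (rule has_dir_deriv_inner_left) (use F Suc.prems in \<open>auto simp: dir_jet_def\<close>)
  then have "has_dir_deriv i (\<lambda>x. pds (replicate m (i, 0) @ replicate n (0, i)) K (x, y)) x
      (inner (F (Suc m) x) (F n y))"
    by (rule has_dir_deriv_cong[OF S \<open>x \<in> S\<close>, rotated]) (use Suc in auto)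
  then show ?case by (simp add: pd_eqI has_dir_deriv_Pair)
qed

lemma rkhs_feature_map:
  assumes "rkhs K ev"
  obtains F where "\<And>h x. ev h x = inner h (F x)" "\<And>x y. inner (F x) (F y) = K x y"
proof -
  obtain F where F: "\<And>x. ev (F x) = K x" "\<And>h x. ev h x = inner h (F x)"
    using assms unfolding rkhs_def by metis
  have "inner (F x) (F y) = K x y" for x y using F by metis
  then show ?thesis using that F by blast
qed

text \<open>The derivative \<open>h\<^sup>(\<^sup>j\<^sup>)(x)\<close> of an element \<open>h\<close> of the space is \<open>\<langle>h, F j x\<rangle>\<close>.\<close>

lemma rkhs_jet:
  fixes ev :: "'h::{real_inner, complete_space} \<Rightarrow> 'a::euclidean_space \<Rightarrow> real"
  assumes H: "rkhs K ev" and S: "open S" and i: "i \<in> Basis"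
    and K: "C_k_on n (S \<times> S) (\<lambda>(x, y). K x y)" and "2 * k \<le> n"
  obtains F where "\<And>h x. ev h x = inner h (F 0 x)" "dir_jet i S k F"
    "\<And>j x. j \<le> k \<Longrightarrow> x \<in> S \<Longrightarrow>
      (norm (F j x))\<^sup>2 = pds (replicate j (i, 0) @ replicate j (0, i)) (\<lambda>(x, y). K x y) (x, x)"
proof -
  obtain F0 where F0: "\<And>h x. ev h x = inner h (F0 x)" "\<And>x y. inner (F0 x) (F0 y) = K x y"
    using rkhs_feature_map[OF H] by metis
  obtain F where F: "F 0 = F0" "dir_jet i S k F"
    using feature_map_jet[OF S i K _ \<open>2 * k \<le> n\<close>, of F0] F0(2) by auto
  show thesis
  proof (rule that)
    show "ev h x = inner h (F 0 x)" for h x by (simp add: F(1) F0(1))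
    show "(norm (F j x))\<^sup>2 = pds (replicate j (i, 0) @ replicate j (0, i)) (\<lambda>(x, y). K x y) (x, x)"
      if "j \<le> k" "x \<in> S" for j x
      unfolding power2_norm_eq_inner
      by (rule pds_inner_jet[OF S F(2), symmetric]) (simp_all add: F(1) F0(2) that)
  qed (rule F(2))
qed

lemma rkhs_continuous:
  fixes ev :: "'h::{real_inner, complete_space} \<Rightarrow> 'a::euclidean_space \<Rightarrow> real"
  assumes H: "rkhs K ev" and K: "mercer_kernel K"
  shows "continuous_on UNIV (ev h)"
proof -
  obtain F where F: "\<And>h x. ev h x = inner h (F x)" "\<And>x y. inner (F x) (F y) = K x y"
    using rkhs_feature_map[OF H] by metis
  have "isCont F x" for x
  proof -
    have KC: "continuous_on UNIV (\<lambda>(x, y). K x y)" using K by (simp add: mercer_kernel_def)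
    have c: "isCont (\<lambda>y. K (p y) (q y)) x" if "isCont p x" "isCont q x" for p q
    proof -
      have "isCont (\<lambda>y. (p y, q y)) x" using that by (intro continuous_intros)
      then show ?thesis
        using isCont_o2[where f = "\<lambda>y. (p y, q y)" and g = "\<lambda>(x, y). K x y" and a = x] KC
        by (simp add: continuous_on_eq_continuous_at)
    qed
    have "norm (F y - F x) = sqrt (K y y - 2 * K y x + K x x)" for y
      by (simp add: norm_eq_sqrt_inner inner_diff_left inner_diff_right F(2)[symmetric] inner_commute)
    moreover have "isCont (\<lambda>y. sqrt (K y y - 2 * K y x + K x x)) x"
      by (intro continuous_intros c)
    ultimately have "((\<lambda>y. norm (F y - F x)) \<longlongrightarrow> 0) (at x)"
      by (simp add: isCont_def)
    then show ?thesis
      unfolding isCont_def by (rule LIM_zero_cancel[OF tendsto_norm_zero_cancel])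
  qed
  then have "continuous_on UNIV F" by (simp add: continuous_on_eq_continuous_at)
  then have "continuous_on UNIV (\<lambda>x. inner h (F x))" by (intro continuous_intros)
  then show ?thesis by (simp add: F(1)[symmetric])
qed


section \<open>Derivatives of the potential \<open>\<phi> + \<psi> * \<rho>\<close>\<close>

lemma has_real_derivative_integral:
  fixes f f' :: "real \<Rightarrow> 'z \<Rightarrow> real"
  assumes d: "0 < d" and f: "\<And>s. \<bar>s\<bar> < d \<Longrightarrow> integrable M (f s)"
    and f': "\<And>s z. \<bar>s\<bar> < d \<Longrightarrow> z \<in> space M \<Longrightarrow> ((\<lambda>s. f s z) has_real_derivative f' s z) (at s)"
    and bound: "\<And>s z. \<bar>s\<bar> < d \<Longrightarrow> z \<in> space M \<Longrightarrow> \<bar>f' s z\<bar> \<le> g z"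
    and g: "integrable M g"
  shows "((\<lambda>s. \<integral>z. f s z \<partial>M) has_real_derivative (\<integral>z. f' 0 z \<partial>M)) (at 0)"
    and "integrable M (f' 0)"
proof -
  define Q where "Q s z = (f s z - f 0 z) / s" for s z
  have quot: "\<bar>Q s z\<bar> \<le> g z" if s: "s \<noteq> 0" "\<bar>s\<bar> < d" and z: "z \<in> space M" for s z
  proof -
    have "has_dir_deriv 1 (\<lambda>s. f s z) (0 + (u * s) *\<^sub>R 1) (f' (0 + (u * s) *\<^sub>R 1) z)"
      if "0 \<le> u" "u \<le> 1" for u
    proof -
      have "\<bar>u * s\<bar> \<le> 1 * \<bar>s\<bar>" unfolding abs_mult using that by (intro mult_right_mono) auto
      then show ?thesis using f'[of "u * s" z] s z by (simp add: has_dir_deriv_one)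
    qed
    from dir_mvt[OF this] obtain u where u: "0 < u" "u < 1" "f s z - f 0 z = s * f' (u * s) z"
      by auto
    have "\<bar>u * s\<bar> \<le> 1 * \<bar>s\<bar>" unfolding abs_mult using u by (intro mult_right_mono) auto
    then show ?thesis using bound[of "u * s" z] s z by (simp add: Q_def u(3))
  qed
  have lim: "(\<lambda>n. Q (s n) z) \<longlonglongrightarrow> f' 0 z"
    if s: "\<And>n. s n \<noteq> 0" "s \<longlonglongrightarrow> 0" and z: "z \<in> space M" for s z
  proof -
    have "((\<lambda>s. Q s z) \<longlongrightarrow> f' 0 z) (at 0)"
      using f'[of 0 z] d z by (simp add: has_field_derivative_iff Q_def)
    moreover have "filterlim s (at 0) sequentially" using s by (intro filterlim_atI) auto
    ultimately show ?thesis by (rule filterlim_compose)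
  qed
  have Q_meas: "Q s \<in> borel_measurable M" if "\<bar>s\<bar> < d" for s
    unfolding Q_def using f[OF that] f[of 0] d by auto
  have f'_meas: "f' 0 \<in> borel_measurable M"
  proof (rule borel_measurable_LIMSEQ_real)
    let ?s = "\<lambda>n. d * inverse (real (Suc (Suc n)))"
    show "Q (?s n) \<in> borel_measurable M" for n
      by (rule Q_meas) (use d in \<open>simp add: abs_mult field_simps add_pos_nonneg\<close>)
    have "?s \<longlonglongrightarrow> d * 0"
      by (rule tendsto_mult_left[OF LIMSEQ_Suc[OF LIMSEQ_inverse_real_of_nat]])
    then show "(\<lambda>n. Q (?s n) z) \<longlonglongrightarrow> f' 0 z" if "z \<in> space M" for z
      by (intro lim that) (use d in auto)
  qed
  show "integrable M (f' 0)"
    by (rule Bochner_Integration.integrable_bound[OF g f'_meas])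
      (use bound[of 0] d in \<open>auto intro!: AE_I2 order_trans[OF _ abs_ge_self]\<close>)
  have "((\<lambda>s. ((\<integral>z. f s z \<partial>M) - (\<integral>z. f 0 z \<partial>M)) / (s - 0)) \<longlongrightarrow> (\<integral>z. f' 0 z \<partial>M))
    (at 0 within {-d<..<d})"
    unfolding tendsto_at_iff_sequentially
  proof (intro allI impI)
    fix s assume "\<forall>n. s n \<in> {-d<..<d} - {0}" and s0: "s \<longlonglongrightarrow> 0"
    then have s: "s n \<noteq> 0" "\<bar>s n\<bar> < d" for n by (auto simp: abs_less_iff minus_less_iff)
    have "(\<lambda>n. \<integral>z. Q (s n) z \<partial>M) \<longlonglongrightarrow> (\<integral>z. f' 0 z \<partial>M)"
      by (rule integral_dominated_convergence[OF f'_meas _ g])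
        (use Q_meas s lim s0 quot in auto)
    moreover have "(\<integral>z. Q (s n) z \<partial>M) = ((\<integral>z. f (s n) z \<partial>M) - (\<integral>z. f 0 z \<partial>M)) / (s n - 0)" for n
      unfolding Q_def using f[OF s(2)[of n]] f[of 0] d by simp
    ultimately show "((\<lambda>s. ((\<integral>z. f s z \<partial>M) - (\<integral>z. f 0 z \<partial>M)) / (s - 0)) \<circ> s)
      \<longlonglongrightarrow> (\<integral>z. f' 0 z \<partial>M)" by (simp add: o_def)
  qed
  then show "((\<lambda>s. \<integral>z. f s z \<partial>M) has_real_derivative (\<integral>z. f' 0 z \<partial>M)) (at 0)"
    using d by (simp add: has_field_derivative_iff at_within_open[of 0 "{-d<..<d}"])
qed

text \<open>Differentiation of \<open>q * \<rho>\<close> with all derivatives falling on \<open>q\<close>, so that \<open>\<rho>\<close> need not be smooth\<close>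

lemma conv_dir_deriv:
  fixes q q' :: "'a::euclidean_space \<Rightarrow> real"
  assumes X: "open X" "x \<in> X"
    and int: "\<And>y. y \<in> X \<Longrightarrow> integrable lborel (\<lambda>z. q (y - z) * rho z)"
    and deriv: "\<And>y z. y \<in> X \<Longrightarrow> rho z \<noteq> 0 \<Longrightarrow> has_dir_deriv i q (y - z) (q' (y - z))"
    and bound: "\<And>y z. y \<in> X \<Longrightarrow> rho z \<noteq> 0 \<Longrightarrow> \<bar>q' (y - z)\<bar> \<le> g z"
    and g: "integrable lborel (\<lambda>z. g z * rho z)" and rho: "\<And>z. 0 \<le> rho z"
  shows "has_dir_deriv i (conv q rho) x (conv q' rho x)"
    and "integrable lborel (\<lambda>z. q' (x - z) * rho z)"
proof -
  obtain d where d: "0 < d" "\<And>s. \<bar>s\<bar> < d \<Longrightarrow> x + s *\<^sub>R i \<in> X"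
    using eventually_on_line[OF X, of i] unfolding eventually_nhds_metric
    by (auto simp: dist_real_def)
  have d1: "((\<lambda>s. q (x + s *\<^sub>R i - z) * rho z) has_real_derivative q' (x + s *\<^sub>R i - z) * rho z) (at s)"
    if "\<bar>s\<bar> < d" for s z
  proof (cases "rho z = 0")
    case False
    have "((\<lambda>s. q (x - z + s *\<^sub>R i)) has_vector_derivative q' (x + s *\<^sub>R i - z)) (at s)"
      by (rule has_dir_deriv_along) (use deriv[OF d(2)[OF that] False] in \<open>simp add: algebra_simps\<close>)
    then have "((\<lambda>s. q (x + s *\<^sub>R i - z)) has_real_derivative q' (x + s *\<^sub>R i - z)) (at s)"
      by (simp add: has_real_derivative_iff_has_vector_derivative algebra_simps)
    then show ?thesis by (rule DERIV_cmult_right)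
  qed simp
  have d2: "\<bar>q' (x + s *\<^sub>R i - z) * rho z\<bar> \<le> g z * rho z" if "\<bar>s\<bar> < d" for s z
    using bound[OF d(2)[OF that], of z] rho[of z]
    by (cases "rho z = 0") (auto simp: abs_mult intro!: mult_right_mono)
  have "((\<lambda>s. \<integral>z. q (x + s *\<^sub>R i - z) * rho z \<partial>lborel) has_real_derivative
      (\<integral>z. q' (x + 0 *\<^sub>R i - z) * rho z \<partial>lborel)) (at 0)"
    by (rule has_real_derivative_integral(1)[OF d(1) _ _ _ g, where f' = "\<lambda>s z. q' (x + s *\<^sub>R i - z) * rho z"])
      (use int d d1 d2 in auto)
  then show "has_dir_deriv i (conv q rho) x (conv q' rho x)"
    by (simp add: has_dir_deriv_real conv_def)
  have "integrable lborel (\<lambda>z. q' (x + 0 *\<^sub>R i - z) * rho z)"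
    by (rule has_real_derivative_integral(2)[OF d(1) _ _ _ g, where f = "\<lambda>s z. q (x + s *\<^sub>R i - z) * rho z"
          and f' = "\<lambda>s z. q' (x + s *\<^sub>R i - z) * rho z"])
      (use int d d1 d2 in auto)
  then show "integrable lborel (\<lambda>z. q' (x - z) * rho z)" by simp
qed

text \<open>\<open>F j\<close> and \<open>G j\<close> represent the \<open>j\<close>-th derivatives, in the direction \<open>i\<close>, of the elements
  \<open>\<phi>\<close> and \<open>\<psi>\<close> of two reproducing kernel Hilbert spaces. The function \<open>g\<close> dominates the
  derivatives of \<open>\<psi>\<close> under the convolution integral. One
  \<open>g\<close> serves all \<open>x \<in> X\<close>. The set \<open>S\<close> on which \<open>\<psi>\<close> is differentiable only has to contain the arguments
  \<open>x - z\<close> with \<open>\<rho>(z) \<noteq> 0\<close>, but \<open>\<psi>\<close> is continuous everywhere, which makes the integrands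
  measurable.\<close>

locale potential_jet =
  fixes i :: "'a::euclidean_space" and X S :: "'a set" and k :: nat
    and F :: "nat \<Rightarrow> 'a \<Rightarrow> 'h1::real_inner" and G :: "nat \<Rightarrow> 'a \<Rightarrow> 'h2::real_inner"
    and rho g :: "'a \<Rightarrow> real"
  assumes X: "open X" and F: "dir_jet i X k F" and G: "dir_jet i S k G"
    and G_cont: "\<And>psi. continuous_on UNIV (\<lambda>y. inner psi (G 0 y))"
    and rho: "\<And>z. 0 \<le> rho z" "rho \<in> borel_measurable borel"
    and args: "\<And>x z. x \<in> X \<Longrightarrow> rho z \<noteq> 0 \<Longrightarrow> x - z \<in> S"
    and bound: "\<And>j x z. j \<le> k \<Longrightarrow> x \<in> X \<Longrightarrow> rho z \<noteq> 0 \<Longrightarrow> norm (G j (x - z)) \<le> g z"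
    and g: "integrable lborel (\<lambda>z. g z * rho z)"
begin

lemma conv_jet:
  assumes "j \<le> k" "x \<in> X"
  shows "integrable lborel (\<lambda>z. inner psi (G j (x - z)) * rho z)"
    and "j < k \<Longrightarrow> has_dir_deriv i (conv (\<lambda>y. inner psi (G j y)) rho) x
      (conv (\<lambda>y. inner psi (G (Suc j) y)) rho x)"
proof -
  have bd: "\<bar>inner psi (G j (x - z))\<bar> \<le> norm psi * g z" if "j \<le> k" "x \<in> X" "rho z \<noteq> 0" for j x z
    by (rule order_trans[OF Cauchy_Schwarz_ineq2 mult_left_mono[OF bound[OF that]]]) simp
  have g': "integrable lborel (\<lambda>z. norm psi * g z * rho z)"
    using integrable_mult_right[OF g, of "norm psi"] by (simp add: mult.assoc)
  have step: "has_dir_deriv i (conv (\<lambda>y. inner psi (G j y)) rho) x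
      (conv (\<lambda>y. inner psi (G (Suc j) y)) rho x) \<and>
      integrable lborel (\<lambda>z. inner psi (G (Suc j) (x - z)) * rho z)"
    if j: "j < k" and x: "x \<in> X"
      and int: "\<And>x. x \<in> X \<Longrightarrow> integrable lborel (\<lambda>z. inner psi (G j (x - z)) * rho z)" for j x
  proof -
    have "has_dir_deriv i (\<lambda>y. inner psi (G j y)) (y - z) (inner psi (G (Suc j) (y - z)))"
      if "y \<in> X" "rho z \<noteq> 0" for y z
      by (rule has_dir_deriv_inner_right) (use G j args[OF that] in \<open>auto simp: dir_jet_def\<close>)
    from conv_dir_deriv[OF X x int this bd[OF Suc_leI[OF j]] g' rho(1)] show ?thesis by blast
  qed
  have int: "integrable lborel (\<lambda>z. inner psi (G j (x - z)) * rho z)" if "j \<le> k" "x \<in> X" for j x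
    using that
  proof (induction j arbitrary: x)
    case 0
    have "(\<lambda>y. inner psi (G 0 y)) \<in> borel_measurable borel"
      by (rule borel_measurable_continuous_onI[OF G_cont])
    then have meas: "(\<lambda>z. inner psi (G 0 (x - z)) * rho z) \<in> borel_measurable lborel"
      using rho(2) by measurable
    have "\<bar>inner psi (G 0 (x - z)) * rho z\<bar> \<le> norm psi * g z * rho z" for z
      using bd[of 0 x z] 0 rho(1)[of z]
      by (cases "rho z = 0") (auto simp: abs_mult intro!: mult_right_mono)
    then show ?case
      by (intro Bochner_Integration.integrable_bound[OF g' meas])
        (auto intro!: AE_I2 order_trans[OF _ abs_ge_self])
  next
    case (Suc j)
    then show ?case using step[of j x] by auto
  qed
  then show "integrable lborel (\<lambda>z. inner psi (G j (x - z)) * rho z)" using assms by blast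
  show "has_dir_deriv i (conv (\<lambda>y. inner psi (G j y)) rho) x
      (conv (\<lambda>y. inner psi (G (Suc j) y)) rho x)" if "j < k"
    using step[OF that assms(2)] int that by simp
qed

lemma conv_jet_bound:
  assumes "j \<le> k" "x \<in> X"
  shows "\<bar>conv (\<lambda>y. inner psi (G j y)) rho x\<bar> \<le> norm psi * (\<integral>z. g z * rho z \<partial>lborel)"
proof -
  have "\<bar>inner psi (G j (x - z)) * rho z\<bar> \<le> norm psi * (g z * rho z)" for z
  proof (cases "rho z = 0")
    case False
    have "\<bar>inner psi (G j (x - z))\<bar> \<le> norm psi * g z"
      by (rule order_trans[OF Cauchy_Schwarz_ineq2 mult_left_mono[OF bound[OF assms False]]]) simp
    then show ?thesis using rho(1)[of z] by (simp add: abs_mult mult_right_mono mult.assoc[symmetric])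
  qed simp
  then have "\<bar>\<integral>z. inner psi (G j (x - z)) * rho z \<partial>lborel\<bar> \<le> (\<integral>z. norm psi * (g z * rho z) \<partial>lborel)"
    using Bochner_Integration.integral_norm_bound_integral[OF conv_jet(1)[OF assms] integrable_mult_right[OF g]] by simp
  then show ?thesis by (simp add: conv_def)
qed

text \<open>The \<open>j\<close>-th derivative of \<open>\<phi> + \<psi> * \<rho>\<close> in the direction \<open>i\<close>, where \<open>u = (\<phi>, \<psi>)\<close>\<close>

definition pot :: "nat \<Rightarrow> 'h1 \<times> 'h2 \<Rightarrow> 'a \<Rightarrow> real" where
  "pot j u x = inner (fst u) (F j x) + conv (\<lambda>y. inner (snd u) (G j y)) rho x"

lemma pot_deriv:
  assumes "j < k" "x \<in> X"
  shows "has_dir_deriv i (pot j u) x (pot (Suc j) u x)"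
proof -
  have "has_dir_deriv i (F j) x (F (Suc j) x)" using F assms by (auto simp: dir_jet_def)
  from has_dir_deriv_add[OF has_dir_deriv_inner_right[OF this] conv_jet(2)]
  show ?thesis using assms by (simp add: pot_def[abs_def])
qed

lemma pot_bound:
  assumes "j \<le> k" "x \<in> X"
  shows "\<bar>pot j u x\<bar> \<le> norm u * (norm (F j x) + (\<integral>z. g z * rho z \<partial>lborel))"
proof -
  have nn: "0 \<le> (\<integral>z. g z * rho z \<partial>lborel)"
  proof (rule integral_nonneg_AE, rule AE_I2)
    fix z show "0 \<le> g z * rho z"
      using order_trans[OF norm_ge_zero bound[OF assms, of z]] rho(1)[of z] by (cases "rho z = 0") auto
  qed
  have u: "norm (fst u) \<le> norm u" "norm (snd u) \<le> norm u"
    by (cases u; simp add: norm_fst_le norm_snd_le)+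
  have "\<bar>inner (fst u) (F j x)\<bar> \<le> norm u * norm (F j x)"
    by (rule order_trans[OF Cauchy_Schwarz_ineq2 mult_right_mono[OF u(1)]]) simp
  moreover have "\<bar>conv (\<lambda>y. inner (snd u) (G j y)) rho x\<bar> \<le> norm u * (\<integral>z. g z * rho z \<partial>lborel)"
    by (rule order_trans[OF conv_jet_bound[OF assms] mult_right_mono[OF u(2) nn]])
  ultimately show ?thesis unfolding pot_def by (simp add: distrib_left)
qed

lemma bounded_linear_pot:
  assumes "j \<le> k" "x \<in> X"
  shows "bounded_linear (\<lambda>u. pot j u x)"
proof (rule bounded_linear_intro)
  show "pot j (u + v) x = pot j u x + pot j v x" for u v
    using conv_jet(1)[OF assms] by (simp add: pot_def conv_def inner_add_left distrib_right)
  show "pot j (r *\<^sub>R u) x = r *\<^sub>R pot j u x" for r u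
    by (simp add: pot_def conv_def mult.assoc distrib_left)
  show "norm (pot j u x) \<le> norm u * (norm (F j x) + (\<integral>z. g z * rho z \<partial>lborel))" for u
    using pot_bound[OF assms] by simp
qed

end


section \<open>The weighted space \<open>L\<^sup>2\<close>\<close>

lemma borel_measurable_integral_snd:
  fixes f :: "'b::{second_countable_topology, t2_space} \<times> 'a::euclidean_space \<Rightarrow> real"
  assumes "f \<in> borel_measurable borel"
  shows "(\<lambda>t. \<integral>x. f (t, x) \<partial>lborel) \<in> borel_measurable borel"
proof (rule lborel.borel_measurable_lebesgue_integral)
  have "sets (borel \<Otimes>\<^sub>M (lborel :: 'a measure)) = sets (borel :: ('b \<times> 'a) measure)"
    unfolding borel_prod[symmetric] by (rule sets_pair_measure_cong) simp_all
  then show "(\<lambda>(t, x). f (t, x)) \<in> borel_measurable (borel \<Otimes>\<^sub>M lborel)"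
    using assms measurable_cong_sets by (metis case_prod_eta)
qed

lemma borel_measurable_comp_continuous:
  assumes "f \<in> borel_measurable borel" "continuous_on UNIV h"
  shows "(\<lambda>x. f (h x)) \<in> borel_measurable borel"
  by (rule measurable_compose[OF borel_measurable_continuous_onI[OF assms(2)] assms(1)])

text \<open>A jointly measurable curve of probability densities on the time interval \<open>[0,T]\<close>\<close>

locale density_family =
  fixes T :: real and rho :: "real \<Rightarrow> 'a::euclidean_space \<Rightarrow> real"
  assumes T: "0 < T" and prob: "\<And>t. t \<in> {0..T} \<Longrightarrow> prob_density (rho t)"
    and rho_meas: "set_borel_measurable borel ({0..T} \<times> UNIV) (\<lambda>(t, x). rho t x)"
begin

text \<open>The extension by zero of a function on \<open>[0,T] \<times> \<real>\<^sup>d\<close>\<close>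

definition cut :: "(real \<Rightarrow> 'a \<Rightarrow> real) \<Rightarrow> real \<times> 'a \<Rightarrow> real" where
  "cut g p = indicator {0..T} (fst p) * g (fst p) (snd p)"

lemma cut_measurable_iff:
  "cut g \<in> borel_measurable borel \<longleftrightarrow> set_borel_measurable borel ({0..T} \<times> UNIV) (\<lambda>(t, x). g t x)"
proof -
  have "cut g = (\<lambda>p. indicator ({0..T} \<times> UNIV) p *\<^sub>R (case p of (t, x) \<Rightarrow> g t x))"
    by (auto simp: cut_def fun_eq_iff indicator_def)
  then show ?thesis by (simp add: set_borel_measurable_def)
qed

lemma cut_rho: "cut rho \<in> borel_measurable borel"
  using rho_meas by (simp add: cut_measurable_iff)

text \<open>Joint measurability and a pointwise bound, both on \<open>[0,T] \<times> \<real>\<^sup>d\<close> only; values at times outside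
  \<open>[0,T]\<close> are irrelevant.\<close>

definition bounded_by :: "real \<Rightarrow> (real \<Rightarrow> 'a \<Rightarrow> real) \<Rightarrow> bool" where
  "bounded_by C g \<longleftrightarrow> cut g \<in> borel_measurable borel \<and> (\<forall>t\<in>{0..T}. \<forall>x. \<bar>g t x\<bar> \<le> C)"

lemma bounded_byD: "bounded_by C g \<Longrightarrow> t \<in> {0..T} \<Longrightarrow> \<bar>g t x\<bar> \<le> C"
  by (simp add: bounded_by_def)

lemma section_measurable:
  assumes "cut g \<in> borel_measurable borel" "t \<in> {0..T}"
  shows "g t \<in> borel_measurable borel"
  using borel_measurable_comp_continuous[OF assms(1), of "\<lambda>x. (t, x)"] assms(2)
  by (simp add: cut_def continuous_intros)

lemma rho_props:
  assumes "t \<in> {0..T}"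
  shows "0 \<le> rho t x" "integrable lborel (rho t)" "(\<integral>x. rho t x \<partial>lborel) = 1"
    "rho t \<in> borel_measurable borel"
  using prob[OF assms] section_measurable[OF cut_rho assms]
  by (auto simp: prob_density_def has_bochner_integral_iff)

lemma slice_integrable:
  assumes g: "bounded_by C g" and h: "bounded_by D h" and t: "t \<in> {0..T}"
  shows "integrable lborel (\<lambda>x. g t x * h t x * rho t x)"
    and "\<bar>\<integral>x. g t x * h t x * rho t x \<partial>lborel\<bar> \<le> C * D"
proof -
  have "0 \<le> C" using bounded_byD[OF g t, of 0] by linarith
  then have le: "\<bar>g t x * h t x * rho t x\<bar> \<le> C * D * rho t x" for x
    using bounded_byD[OF g t, of x] bounded_byD[OF h t, of x] rho_props(1)[OF t, of x]
    by (auto simp: abs_mult intro!: mult_right_mono mult_mono)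
  have I: "integrable lborel (\<lambda>x. C * D * rho t x)" using rho_props(2)[OF t] by simp
  have "g t \<in> borel_measurable lborel" "h t \<in> borel_measurable lborel" "rho t \<in> borel_measurable lborel"
    using g h t rho_props(4)[OF t] by (auto simp: bounded_by_def intro: section_measurable)
  then have "(\<lambda>x. g t x * h t x * rho t x) \<in> borel_measurable lborel" by measurable
  then show int: "integrable lborel (\<lambda>x. g t x * h t x * rho t x)"
    by (rule Bochner_Integration.integrable_bound[OF I])
      (auto intro!: AE_I2 order_trans[OF le abs_ge_self])
  have "\<bar>\<integral>x. g t x * h t x * rho t x \<partial>lborel\<bar> \<le> (\<integral>x. C * D * rho t x \<partial>lborel)"
    using Bochner_Integration.integral_norm_bound_integral[OF int I] le by simp
  then show "\<bar>\<integral>x. g t x * h t x * rho t x \<partial>lborel\<bar> \<le> C * D" using rho_props(3)[OF t] by simp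
qed

lemma time_integrable:
  assumes g: "bounded_by C g" and h: "bounded_by D h"
  shows "set_integrable lborel {0..T} (\<lambda>t. \<integral>x. g t x * h t x * rho t x \<partial>lborel)"
proof -
  let ?I = "\<lambda>t. \<integral>x. g t x * h t x * rho t x \<partial>lborel"
  have "(\<lambda>t. \<integral>x. cut g (t, x) * cut h (t, x) * cut rho (t, x) \<partial>lborel) \<in> borel_measurable borel"
    by (rule borel_measurable_integral_snd[where f = "\<lambda>p. cut g p * cut h p * cut rho p"])
      (use g h cut_rho in \<open>auto simp: bounded_by_def\<close>)
  moreover have "(\<integral>x. cut g (t, x) * cut h (t, x) * cut rho (t, x) \<partial>lborel) = indicator {0..T} t *\<^sub>R ?I t" for t
    by (cases "t \<in> {0..T}") (simp_all add: cut_def)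
  ultimately have meas: "(\<lambda>t. indicator {0..T} t *\<^sub>R ?I t) \<in> borel_measurable lborel" by simp
  have "\<bar>indicator {0..T} t *\<^sub>R ?I t\<bar> \<le> indicator {0..T} t *\<^sub>R (C * D)" for t
    using slice_integrable(2)[OF g h, of t] by (cases "t \<in> {0..T}") auto
  moreover have I: "integrable lborel (\<lambda>t. indicator {0..T} t *\<^sub>R (C * D))"
    by (intro integrable_scaleR_left integrable_real_indicator) (simp_all add: emeasure_lborel_Icc_eq)
  ultimately show ?thesis
    unfolding set_integrable_def
    by (intro Bochner_Integration.integrable_bound[OF I meas] AE_I2)
      (simp only: real_norm_def, rule order_trans[OF _ abs_ge_self], blast)
qed

abbreviation ip where "ip \<equiv> L2_inner T rho"

lemma ip_cong:
  assumes "\<And>t x. t \<in> {0..T} \<Longrightarrow> g t x = g' t x" "\<And>t x. t \<in> {0..T} \<Longrightarrow> h t x = h' t x"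
  shows "ip g h = ip g' h'"
  unfolding L2_inner_def using assms by (intro set_lebesgue_integral_cong) auto

lemma ip_commute: "ip g h = ip h g"
  unfolding L2_inner_def by (simp add: mult.commute)

lemma ip_scale_left: "ip (\<lambda>t x. c * g t x) h = c * ip g h"
  unfolding L2_inner_def by (simp add: mult.assoc)

lemma ip_nonneg: "0 \<le> ip g g"
  unfolding L2_inner_def set_lebesgue_integral_def
  by (intro integral_nonneg_AE AE_I2) (auto simp: indicator_def rho_props intro!: integral_nonneg_AE AE_I2)

lemma ip_add_left:
  assumes "bounded_by C g" "bounded_by C' g'" "bounded_by D h"
  shows "ip (\<lambda>t x. g t x + g' t x) h = ip g h + ip g' h"
proof -
  have "ip (\<lambda>t x. g t x + g' t x) h = (LINT t:{0..T}|lborel.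
      (\<integral>x. g t x * h t x * rho t x \<partial>lborel) + (\<integral>x. g' t x * h t x * rho t x \<partial>lborel))"
    unfolding L2_inner_def using assms
    by (intro set_lebesgue_integral_cong)
      (auto simp: distrib_right slice_integrable(1) intro!: Bochner_Integration.integral_add)
  also have "\<dots> = ip g h + ip g' h"
    unfolding L2_inner_def using assms by (intro set_integral_add time_integrable)
  finally show ?thesis .
qed

lemma ip_bound:
  assumes "bounded_by C g" "bounded_by D h"
  shows "\<bar>ip g h\<bar> \<le> C * D * T"
proof -
  have "\<bar>ip g h\<bar> \<le> (LINT t:{0..T}|lborel. \<bar>\<integral>x. g t x * h t x * rho t x \<partial>lborel\<bar>)"
    unfolding L2_inner_def using set_integral_norm_bound[OF time_integrable[OF assms]] by simp
  also have "\<dots> \<le> (LINT t:{0..T}|lborel. C * D)"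
  proof (rule set_integral_mono)
    show "set_integrable lborel {0..T} (\<lambda>t. \<bar>\<integral>x. g t x * h t x * rho t x \<partial>lborel\<bar>)"
      using time_integrable[OF assms] by (rule set_integrable_abs)
    show "set_integrable lborel {0..T} (\<lambda>t. C * D)"
      unfolding set_integrable_def by (intro integrable_scaleR_left integrable_real_indicator) (simp_all add: emeasure_lborel_Icc_eq)
    show "\<bar>\<integral>x. g t x * h t x * rho t x \<partial>lborel\<bar> \<le> C * D" if "t \<in> {0..T}" for t
      by (rule slice_integrable(2)[OF assms that])
  qed
  also have "\<dots> = C * D * T" using T by (simp add: set_lebesgue_integral_def)
  finally show ?thesis .
qed

lemma bounded_by_L2:
  assumes g: "bounded_by C g"
  shows "g \<in> L2_space T rho"
proof -
  have slice: "(\<integral>\<^sup>+x. ennreal (\<bar>g t x\<bar>\<^sup>2 * rho t x) \<partial>lborel) \<le> ennreal (C * C)" if t: "t \<in> {0..T}" for t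
  proof -
    have "(\<integral>\<^sup>+x. ennreal (\<bar>g t x\<bar>\<^sup>2 * rho t x) \<partial>lborel) = ennreal (\<integral>x. g t x * g t x * rho t x \<partial>lborel)"
      using nn_integral_eq_integral[OF slice_integrable(1)[OF g g t]] rho_props(1)[OF t]
      by (simp add: power2_eq_square)
    also have "\<dots> \<le> ennreal (C * C)"
      using slice_integrable(2)[OF g g t] by (intro ennreal_leI) linarith
    finally show ?thesis .
  qed
  have "(\<integral>\<^sup>+t\<in>{0..T}. (\<integral>\<^sup>+x. ennreal (\<bar>g t x\<bar>\<^sup>2 * rho t x) \<partial>lborel) \<partial>lborel)
      \<le> (\<integral>\<^sup>+t. ennreal (C * C) * indicator {0..T} t \<partial>lborel)"
    by (intro nn_integral_mono) (auto simp: indicator_def intro: slice[unfolded power2_abs])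
  also have "\<dots> = ennreal (C * C) * ennreal T"
    using T by (simp add: nn_integral_cmult_indicator)
  also have "\<dots> < \<infinity>" by (simp add: ennreal_mult_less_top)
  finally show ?thesis
    using g by (simp add: L2_space_def bounded_by_def cut_measurable_iff)
qed

text \<open>An operator that is bounded into the sup norm on \<open>[0,T] \<times> \<real>\<^sup>d\<close> is bounded into \<open>L\<^sup>2\<close>,
  since the \<open>\<rho>\<^sub>t\<close> are probability densities.\<close>

lemma bounded_bilinear_ip:
  fixes A :: "'h::real_normed_vector \<Rightarrow> real \<Rightarrow> 'a \<Rightarrow> real"
  assumes bd: "\<And>u. bounded_by (C * norm u) (A u)"
    and add: "\<And>u v t x. t \<in> {0..T} \<Longrightarrow> A (u + v) t x = A u t x + A v t x"
    and scale: "\<And>r u t x. t \<in> {0..T} \<Longrightarrow> A (r *\<^sub>R u) t x = r * A u t x"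
  shows "bounded_bilinear (\<lambda>u v. ip (A u) (A v))"
proof -
  have left: "ip (A (u + v)) (A w) = ip (A u) (A w) + ip (A v) (A w)" for u v w
    using ip_add_left[OF bd bd bd, of u v w] ip_cong[of "A (u + v)" "\<lambda>t x. A u t x + A v t x" "A w" "A w"]
    by (simp add: add)
  have scl: "ip (A (r *\<^sub>R u)) (A w) = r * ip (A u) (A w)" for r u w
    using ip_scale_left[of r "A u" "A w"] ip_cong[of "A (r *\<^sub>R u)" "\<lambda>t x. r * A u t x" "A w" "A w"]
    by (simp add: scale)
  show ?thesis
  proof
    show "ip (A (u + v)) (A w) = ip (A u) (A w) + ip (A v) (A w)" for u v w by (rule left)
    show "ip (A w) (A (u + v)) = ip (A w) (A u) + ip (A w) (A v)" for u v w
      unfolding ip_commute[of "A w"] by (rule left)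
    show "ip (A (r *\<^sub>R u)) (A w) = r *\<^sub>R ip (A u) (A w)" for r u w using scl by simp
    show "ip (A w) (A (r *\<^sub>R u)) = r *\<^sub>R ip (A w) (A u)" for r u w
      unfolding ip_commute[of "A w"] using scl by simp
    have "norm (ip (A u) (A v)) \<le> norm u * norm v * (C * C * T)" for u v
      using ip_bound[OF bd bd, of u v] by (simp add: mult_ac)
    then show "\<exists>K. \<forall>u v. norm (ip (A u) (A v)) \<le> norm u * norm v * K" by blast
  qed
qed

end


section \<open>The continuous problem\<close>

lemma pds_le_Cb_norm:
  assumes "Cb_norm k f \<le> ennreal M" "0 \<le> M" "set js \<subseteq> Basis" "length js \<le> k"
  shows "\<bar>pds js f x\<bar> \<le> M"
proof -
  have "ennreal \<bar>pds js f x\<bar> \<le> (SUP x. ennreal \<bar>pds js f x\<bar>)" by (rule SUP_upper) simp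
  also have "\<dots> \<le> Cb_norm k f" unfolding Cb_norm_def by (rule SUP_upper) (use assms in simp)
  finally show ?thesis using assms(1,2) order_trans ennreal_le_iff by metis
qed

lemma rkhs_bounded_jet:
  fixes ev :: "'h::{real_inner, complete_space} \<Rightarrow> 'a::euclidean_space \<Rightarrow> real"
  assumes H: "rkhs K ev" and K: "C_b n (\<lambda>(x, y). K x y)" and "2 * k \<le> n"
  obtains F c where "0 \<le> c" "\<And>i h x. i \<in> Basis \<Longrightarrow> ev h x = inner h (F i 0 x)"
    "\<And>i. i \<in> Basis \<Longrightarrow> dir_jet i UNIV k (F i)"
    "\<And>i j x. i \<in> Basis \<Longrightarrow> j \<le> k \<Longrightarrow> norm (F i j x) \<le> c"
proof -
  let ?K = "\<lambda>(x, y). K x y"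
  define M where "M = enn2real (Cb_norm n ?K)"
  have M: "0 \<le> M" "Cb_norm n ?K \<le> ennreal M" using K by (auto simp: M_def C_b_def)
  have C: "C_k_on n (UNIV \<times> UNIV) ?K"
    using K by (simp add: C_b_def)
  have "\<exists>F. (\<forall>h x. ev h x = inner h (F 0 x)) \<and> dir_jet i UNIV k F \<and>
      (\<forall>j\<le>k. \<forall>x. norm (F j x) \<le> sqrt M)" if i: "i \<in> Basis" for i :: 'a
  proof -
    obtain F where F: "\<And>h x. ev h x = inner h (F 0 x)" "dir_jet i UNIV k F"
      "\<And>j x. j \<le> k \<Longrightarrow> x \<in> UNIV \<Longrightarrow>
        (norm (F j x))\<^sup>2 = pds (replicate j (i, 0) @ replicate j (0, i)) ?K (x, x)"
      by (rule rkhs_jet[OF H open_UNIV i C \<open>2 * k \<le> n\<close>]) blast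
    have "norm (F j x) \<le> sqrt M" if "j \<le> k" for j x
    proof (rule real_le_rsqrt)
      have "\<bar>pds (replicate j (i, 0) @ replicate j (0, i)) ?K (x, x)\<bar> \<le> M"
        by (rule pds_le_Cb_norm[OF M(2,1)])
          (use that \<open>2 * k \<le> n\<close> i in \<open>auto simp: Basis_prod_def set_replicate_conv_if\<close>)
      then show "(norm (F j x))\<^sup>2 \<le> M" using F(3)[OF that, of x] by simp
    qed
    then show ?thesis using F by blast
  qed
  then obtain F where "\<forall>i\<in>Basis. (\<forall>h x. ev h x = inner h (F i 0 x)) \<and> dir_jet i UNIV k (F i) \<and>
      (\<forall>j\<le>k. \<forall>x. norm (F i j x) \<le> sqrt M)"
    by metis
  then show ?thesis using that[of "sqrt M" F] M by auto
qed

lemma dir_jet_inner_measurable: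
  assumes F: "dir_jet i UNIV k F" and cont: "continuous_on UNIV (\<lambda>y. inner h (F 0 y))"
    and "j \<le> k"
  shows "(\<lambda>y::'a::euclidean_space. inner h (F j y)) \<in> borel_measurable borel"
  using \<open>j \<le> k\<close>
proof (induction j)
  case 0
  then show ?case using cont by (simp add: borel_measurable_continuous_onI)
next
  case (Suc j)
  show ?case
  proof (rule borel_measurable_dir_deriv)
    show "(\<lambda>y. inner h (F j (y + s *\<^sub>R i))) \<in> borel_measurable borel" for s
      by (rule borel_measurable_comp_continuous[where f = "\<lambda>y. inner h (F j y)"])
        (use Suc in \<open>auto intro!: continuous_intros\<close>)
    show "((\<lambda>s. inner h (F j (y + s *\<^sub>R i))) has_real_derivative inner h (F (Suc j) y)) (at 0)" for y
      using has_dir_deriv_inner_right[of i "F j" y "F (Suc j) y" h] F Suc.prems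
      by (simp add: has_dir_deriv_real dir_jet_def)
  qed
qed

context density_family
begin

lemma cut_pot_measurable:
  assumes q: "q \<in> borel_measurable borel" and q': "q' \<in> borel_measurable borel"
  shows "cut (\<lambda>t x. q x + conv q' (rho t) x) \<in> borel_measurable borel"
proof -
  have 1: "(\<lambda>p :: real \<times> 'a. indicator ({0..T} \<times> UNIV) p * q (snd p)) \<in> borel_measurable borel"
    using borel_measurable_comp_continuous[OF q continuous_on_snd[OF continuous_on_id]]
    by (intro borel_measurable_times borel_measurable_indicator) (simp_all add: borel_closed closed_Times)
  have "(\<lambda>w :: (real \<times> 'a) \<times> 'a. q' (snd (fst w) - snd w) * cut rho (fst (fst w), snd w)) \<in> borel_measurable borel"
    by (intro borel_measurable_times borel_measurable_comp_continuous[OF q']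
        borel_measurable_comp_continuous[OF cut_rho] continuous_intros)
  from borel_measurable_integral_snd[OF this]
  have 2: "(\<lambda>p. \<integral>z. q' (snd p - z) * cut rho (fst p, z) \<partial>lborel) \<in> borel_measurable borel" by simp
  have "cut (\<lambda>t x. q x + conv q' (rho t) x) = (\<lambda>p. indicator ({0..T} \<times> UNIV) p * q (snd p)
      + (\<integral>z. q' (snd p - z) * cut rho (fst p, z) \<partial>lborel))"
    by (auto simp: fun_eq_iff cut_def conv_def indicator_def)
  then show ?thesis using 1 2 by simp
qed

lemma cut_pd_measurable:
  assumes "\<And>t x. t \<in> {0..T} \<Longrightarrow> has_dir_deriv i (rho t) x (pd i (rho t) x)"
  shows "cut (\<lambda>t. pd i (rho t)) \<in> borel_measurable borel"
proof (rule borel_measurable_dir_deriv)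
  show "(\<lambda>p. cut rho (fst p, snd p + s *\<^sub>R i)) \<in> borel_measurable borel" for s
    by (intro borel_measurable_comp_continuous[OF cut_rho] continuous_intros)
  show "((\<lambda>s. cut rho (fst p, snd p + s *\<^sub>R i)) has_real_derivative cut (\<lambda>t. pd i (rho t)) p) (at 0)" for p
    using assms[of "fst p" "snd p"] by (cases "fst p \<in> {0..T}") (simp_all add: cut_def has_dir_deriv_real)
qed

text \<open>By the product rule, \<open>\<Delta>\<^sub>\<rho>f = \<Sum>\<^sub>i (\<partial>\<^sub>i\<rho> \<partial>\<^sub>if + \<rho> \<partial>\<^sub>i\<^sub>if)\<close> involves only pure second derivatives of
  \<open>f = \<phi> + \<psi> * \<rho>\<close>, and these are bounded by a multiple of the norm of \<open>(\<phi>, \<psi>)\<close>.\<close>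

lemma A_op_bounded:
  fixes ev1 :: "'h1::{real_inner, complete_space} \<Rightarrow> 'a \<Rightarrow> real"
    and ev2 :: "'h2::{real_inner, complete_space} \<Rightarrow> 'a \<Rightarrow> real"
  assumes merc: "mercer_kernel K1" "mercer_kernel K2"
    and K: "C_b 5 (\<lambda>(x, y). K1 x y)" "C_b 5 (\<lambda>(x, y). K2 x y)"
    and H: "rkhs K1 ev1" "rkhs K2 ev2" and dens: "densities 1 T rho"
  shows "\<exists>C. \<forall>u. bounded_by (C * norm u) (A_op rho ev1 ev2 u)"
    and "\<And>t x. t \<in> {0..T} \<Longrightarrow> linear (\<lambda>u. A_op rho ev1 ev2 u t x)"
proof -
  let ?A = "A_op rho ev1 ev2"
  define M where "M = enn2real (SUP t\<in>{0..T}. Cb_norm 1 (rho t))"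
  have SUP: "(SUP t\<in>{0..T}. Cb_norm 1 (rho t)) = ennreal M"
    using dens by (simp add: M_def densities_def)
  have M: "0 \<le> M" by (simp add: M_def)
  have rho_norm: "Cb_norm 1 (rho t) \<le> ennreal M" if "t \<in> {0..T}" for t
    unfolding SUP[symmetric] using that by (rule SUP_upper)
  have rho_le: "\<bar>rho t x\<bar> \<le> M" if "t \<in> {0..T}" for t x
    using pds_le_Cb_norm[OF rho_norm[OF that] M, of "[]"] by simp
  have pd_le: "\<bar>pd i (rho t) x\<bar> \<le> M" if "t \<in> {0..T}" "i \<in> Basis" for t i x
    using pds_le_Cb_norm[OF rho_norm[OF that(1)] M, of "[i]"] that by simp
  have rho_deriv: "has_dir_deriv i (rho t) x (pd i (rho t) x)" if "t \<in> {0..T}" "i \<in> Basis" for t i x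
    using C_k_on_dir_deriv[of 1 UNIV "rho t" "[]" i x] dens that by (simp add: densities_def)
  obtain F c1 where c1: "0 \<le> c1" and F: "\<And>i h x. i \<in> Basis \<Longrightarrow> ev1 h x = inner h (F i 0 x)"
    "\<And>i. i \<in> Basis \<Longrightarrow> dir_jet i UNIV 2 (F i)"
    "\<And>i j x. i \<in> Basis \<Longrightarrow> j \<le> 2 \<Longrightarrow> norm (F i j x) \<le> c1"
    by (rule rkhs_bounded_jet[OF H(1) K(1), of 2]) (simp, blast)
  obtain G c2 where c2: "0 \<le> c2" and G: "\<And>i h x. i \<in> Basis \<Longrightarrow> ev2 h x = inner h (G i 0 x)"
    "\<And>i. i \<in> Basis \<Longrightarrow> dir_jet i UNIV 2 (G i)"
    "\<And>i j x. i \<in> Basis \<Longrightarrow> j \<le> 2 \<Longrightarrow> norm (G i j x) \<le> c2"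
    by (rule rkhs_bounded_jet[OF H(2) K(2), of 2]) (simp, blast)
  have F_cont: "continuous_on UNIV (\<lambda>y. inner h (F i 0 y))" if "i \<in> Basis" for h i
    using rkhs_continuous[OF H(1) merc(1), of h] by (simp add: F(1)[OF that, abs_def])
  have G_cont: "continuous_on UNIV (\<lambda>y. inner h (G i 0 y))" if "i \<in> Basis" for h i
    using rkhs_continuous[OF H(2) merc(2), of h] by (simp add: G(1)[OF that, abs_def])
  have jet: "potential_jet i UNIV UNIV 2 (F i) (G i) (rho t) (\<lambda>_. c2)"
    if "t \<in> {0..T}" "i \<in> Basis" for t i
    by standard (use that F G G_cont rho_props in auto)
  \<comment> \<open>the maps \<open>F i 0\<close> represent the same evaluations for every axis \<open>i\<close>, only the derivatives differ\<close>
  define P where "P i t = potential_jet.pot (F i) (G i) (rho t)" for i t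
  have P: "P i t j u x = inner (fst u) (F i j x) + conv (\<lambda>y. inner (snd u) (G i j y)) (rho t) x"
    if "t \<in> {0..T}" "i \<in> Basis" for i t j u x
    unfolding P_def by (rule potential_jet.pot_def[OF jet[OF that]])
  have P_deriv: "has_dir_deriv i (P i t j u) x (P i t (Suc j) u x)"
    if "t \<in> {0..T}" "i \<in> Basis" "j < 2" for i t j u x
    unfolding P_def by (rule potential_jet.pot_deriv[OF jet[OF that(1,2)] that(3)]) simp
  have P_bound: "\<bar>P i t j u x\<bar> \<le> norm u * (c1 + c2)"
    if "t \<in> {0..T}" "i \<in> Basis" "j \<le> 2" for i t j u x
  proof -
    have "\<bar>P i t j u x\<bar> \<le> norm u * (norm (F i j x) + (\<integral>z. c2 * rho t z \<partial>lborel))"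
      unfolding P_def by (rule potential_jet.pot_bound[OF jet[OF that(1,2)] that(3)]) simp
    also have "\<dots> \<le> norm u * (c1 + c2)"
      using F(3)[OF that(2,3), of x] by (intro mult_left_mono add_mono) (simp_all add: rho_props(3)[OF that(1)])
    finally show ?thesis .
  qed
  have P_linear: "bounded_linear (\<lambda>u. P i t j u x)" if "t \<in> {0..T}" "i \<in> Basis" "j \<le> 2" for i t j x
    unfolding P_def
    by (rule potential_jet.bounded_linear_pot[OF jet[OF that(1,2)] that(3)]) simp
  have A: "?A u t x = (\<Sum>i\<in>Basis. pd i (rho t) x * P i t 1 u x + rho t x * P i t 2 u x)"
    if t: "t \<in> {0..T}" for u t x
  proof -
    have "pd i (\<lambda>y. rho t y * pd i (\<lambda>y. ev1 (fst u) y + conv (ev2 (snd u)) (rho t) y) y) x =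
        pd i (rho t) x * P i t 1 u x + rho t x * P i t 2 u x" if i: "i \<in> Basis" for i
    proof -
      have "(\<lambda>y. ev1 (fst u) y + conv (ev2 (snd u)) (rho t) y) = P i t 0 u"
        by (simp add: fun_eq_iff P[OF t i] F(1)[OF i] G(1)[OF i, abs_def])
      moreover have "pd i (P i t 0 u) = P i t 1 u"
        using pd_eqI[OF P_deriv[OF t i, of 0]] by (simp add: fun_eq_iff)
      moreover have "has_dir_deriv i (P i t 1 u) x (P i t 2 u x)"
        using P_deriv[OF t i, of 1] by (simp add: numeral_2_eq_2)
      ultimately show ?thesis
        using pd_eqI[OF has_dir_deriv_mult[OF rho_deriv[OF t i]]] by simp
    qed
    then show ?thesis by (simp add: A_op_def wlap_def case_prod_unfold)
  qed
  show "linear (\<lambda>u. ?A u t x)" if t: "t \<in> {0..T}" for t x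
    unfolding A[OF t]
    by (intro bounded_linear.linear bounded_linear_sum bounded_linear_add bounded_linear_const_mult
        P_linear t) auto
  let ?C = "real DIM('a) * (2 * M * (c1 + c2))"
  have "bounded_by (?C * norm u) (?A u)" for u
    unfolding bounded_by_def
  proof (intro conjI ballI allI)
    have "cut (?A u) = (\<lambda>p. \<Sum>i\<in>Basis. cut (\<lambda>t. pd i (rho t)) p *
        cut (\<lambda>t x. inner (fst u) (F i 1 x) + conv (\<lambda>y. inner (snd u) (G i 1 y)) (rho t) x) p +
        cut rho p * cut (\<lambda>t x. inner (fst u) (F i 2 x) + conv (\<lambda>y. inner (snd u) (G i 2 y)) (rho t) x) p)"
      (is "_ = ?rhs")
    proof
      fix p show "cut (?A u) p = ?rhs p"
        by (cases "fst p \<in> {0..T}") (simp_all add: cut_def A P)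
    qed
    also have "\<dots> \<in> borel_measurable borel"
      by (intro borel_measurable_sum borel_measurable_add borel_measurable_times cut_rho
          cut_pot_measurable cut_pd_measurable rho_deriv dir_jet_inner_measurable[OF F(2) F_cont]
          dir_jet_inner_measurable[OF G(2) G_cont]) auto
    finally show "cut (?A u) \<in> borel_measurable borel" .
  next
    fix t x assume t: "t \<in> {0..T}"
    have "\<bar>?A u t x\<bar> \<le> (\<Sum>i\<in>(Basis :: 'a set). M * (norm u * (c1 + c2)) + M * (norm u * (c1 + c2)))"
      unfolding A[OF t]
    proof (rule order_trans[OF sum_abs sum_mono])
      fix i :: 'a assume i: "i \<in> Basis"
      have "\<bar>pd i (rho t) x * P i t 1 u x\<bar> \<le> M * (norm u * (c1 + c2))"
        unfolding abs_mult using M by (intro mult_mono pd_le P_bound t i) auto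
      moreover have "\<bar>rho t x * P i t 2 u x\<bar> \<le> M * (norm u * (c1 + c2))"
        unfolding abs_mult using M by (intro mult_mono rho_le P_bound t i) auto
      ultimately show "\<bar>pd i (rho t) x * P i t 1 u x + rho t x * P i t 2 u x\<bar>
          \<le> M * (norm u * (c1 + c2)) + M * (norm u * (c1 + c2))" by linarith
    qed
    also have "\<dots> = ?C * norm u" by (simp add: algebra_simps)
    finally show "\<bar>?A u t x\<bar> \<le> ?C * norm u" .
  qed
  then show "\<exists>C. \<forall>u. bounded_by (C * norm u) (?A u)" by blast
qed

lemma continuous_tikhonov:
  fixes ev1 :: "'h1::{real_inner, complete_space} \<Rightarrow> 'a \<Rightarrow> real"
    and ev2 :: "'h2::{real_inner, complete_space} \<Rightarrow> 'a \<Rightarrow> real" and w :: "'h1 \<times> 'h2"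
  assumes lam: "0 < lam1" "0 < lam2"
    and bd: "\<And>u. bounded_by (C * norm u) (A_op rho ev1 ev2 u)"
    and lin: "\<And>t x. t \<in> {0..T} \<Longrightarrow> linear (\<lambda>u. A_op rho ev1 ev2 u t x)"
  defines "BL \<equiv> \<lambda>u. B_op T rho ev1 ev2 u + lamI lam1 lam2 u"
    and "R \<equiv> R_risk T rho ev1 ev2 w lam1 lam2"
  shows "bij BL" and "\<exists>!u. is_arg_min R (\<lambda>_. True) u"
    and "is_arg_min R (\<lambda>_. True) u \<Longrightarrow> u = inv BL (B_op T rho ev1 ev2 w)"
proof -
  let ?A = "A_op rho ev1 ev2" and ?B = "B_op T rho ev1 ev2"
  define bf where "bf u v = ip (?A u) (?A v)" for u v
  have bf: "bounded_bilinear bf"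
    unfolding bf_def[abs_def]
    by (rule bounded_bilinear_ip[OF bd]) (simp_all add: linear_add[OF lin] linear_scale[OF lin])
  interpret bf: bounded_bilinear bf by (rule bf)
  have sym: "bf u v = bf v u" for u v unfolding bf_def by (rule ip_commute)
  have psd: "0 \<le> bf u u" for u unfolding bf_def by (rule ip_nonneg)
  have B: "bf u v = inner u (?B v)" for u v
    using inner_adjoint_wrt[of ip ?A "?A v" u] bf.bounded_linear_left[of v]
    by (simp add: bf_def B_op_def)
  have R: "R u = bf u u - 2 * inner u (?B w) + bf w w + inner u (lamI lam1 lam2 u)" for u
  proof -
    have "ip (\<lambda>t x. ?A u t x - ?A w t x) (\<lambda>t x. ?A u t x - ?A w t x) = bf (u - w) (u - w)"
      unfolding bf_def by (intro ip_cong) (simp_all add: linear_diff[OF lin])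
    then have "(L2_norm T rho (\<lambda>t x. ?A u t x - ?A w t x))\<^sup>2 = bf (u - w) (u - w)"
      using psd by (simp add: L2_norm_def)
    also have "\<dots> = bf u u - 2 * inner u (?B w) + bf w w"
      by (simp add: bf.diff_left bf.diff_right sym[of w u] B[of u w, symmetric])
    finally show ?thesis
      unfolding R_def R_risk_def by (simp add: case_prod_unfold inner_lamI power2_norm_eq_inner)
  qed
  have m: "0 < min lam1 lam2" using lam by simp
  note main = regularised_least_squares[OF bf sym psd B bounded_linear_lamI lamI_symmetric m lamI_coercive R]
  show "bij BL" unfolding BL_def by (rule main(1))
  show "\<exists>!u. is_arg_min R (\<lambda>_. True) u" by (rule main(2))
  show "u = inv BL (?B w)" if "is_arg_min R (\<lambda>_. True) u"
    using main(3)[OF that] unfolding BL_def .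
qed

end


section \<open>The discrete problem\<close>

lemma A_delta_eq_pot:
  fixes ev1 :: "'h1::real_inner \<Rightarrow> real \<Rightarrow> real" and ev2 :: "'h2::real_inner \<Rightarrow> real \<Rightarrow> real"
  assumes "potential_jet 1 X S 2 F G (rho (gt T L l)) g" and x: "gx a b N n \<in> X"
    and ev1: "\<And>h x. ev1 h x = inner h (F 0 x)" and ev2: "\<And>h x. ev2 h x = inner h (G 0 x)"
  shows "A_delta a b N T L rho ev1 ev2 u l n =
    dx_fwd a b N T L rho l n * potential_jet.pot F G (rho (gt T L l)) 1 u (gx a b N n) +
    rho (gt T L l) (gx a b N n) * potential_jet.pot F G (rho (gt T L l)) 2 u (gx a b N n)"
proof -
  interpret potential_jet 1 X S 2 F G "rho (gt T L l)" g by fact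
  have g: "(\<lambda>x. ev1 (fst u) x + conv (ev2 (snd u)) (rho (gt T L l)) x) = pot 0 u"
    by (simp add: pot_def fun_eq_iff ev1 ev2[abs_def])
  have d1: "(pot 0 u has_real_derivative pot 1 u y) (at y)" if "y \<in> X" for y
    using pot_deriv[of 0 y u] that by (simp add: has_dir_deriv_one)
  have "has_dir_deriv 1 (deriv (pot 0 u)) (gx a b N n) (pot 2 u (gx a b N n))"
    by (rule has_dir_deriv_cong[OF X x _ pot_deriv[of 1 "gx a b N n" u, simplified, folded numeral_2_eq_2]])
      (use DERIV_imp_deriv[OF d1] x in auto)
  then have "deriv (deriv (pot 0 u)) (gx a b N n) = pot 2 u (gx a b N n)"
    by (simp add: has_dir_deriv_one DERIV_imp_deriv)
  then show ?thesis
    using DERIV_imp_deriv[OF d1[OF x]] g by (simp add: A_delta_def case_prod_unfold Let_def)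
qed

lemma bounded_linear_A_delta:
  fixes ev1 :: "'h1::{real_inner, complete_space} \<Rightarrow> real \<Rightarrow> real"
    and ev2 :: "'h2::{real_inner, complete_space} \<Rightarrow> real \<Rightarrow> real"
  assumes T: "0 < T" and ab: "a < b" and K2: "mercer_kernel K2"
    and H: "rkhs K1 ev1" "rkhs K2 ev2"
    and rho: "\<And>t. t \<in> {0..T} \<Longrightarrow> prob_density (rho t)"
    and C4: "kernels_C4 a b T rho K1 K2"
    and l: "l \<in> {1..L}" and n: "n \<in> {1..N}"
  shows "bounded_linear (\<lambda>u. A_delta a b N T L rho ev1 ev2 u l n)"
proof -
  let ?t = "gt T L l" and ?x = "gx a b N n"
  have "real l * T \<le> real L * T" using l T by simp
  then have t: "?t \<in> {0..T}" using l T by (simp add: gt_def field_simps)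
  obtain e where e: "0 < e" and C1: "C_k_on 4 (near a b e \<times> near a b e) (\<lambda>(x, y). K1 x y)"
    and C2: "C_k_on 4 (conv_args a b T rho e \<times> conv_args a b T rho e) (\<lambda>(x, y). K2 x y)"
    and dom: "\<And>t. t \<in> {0..T} \<Longrightarrow> \<exists>g. integrable lborel (\<lambda>z. g z * rho t z) \<and>
        (\<forall>j\<le>2. \<forall>x\<in>near a b e. \<forall>z. rho t z \<noteq> 0 \<longrightarrow> eval_norm K2 j (x - z) \<le> g z)"
    using C4 unfolding kernels_C4_def by blast
  obtain g where g: "integrable lborel (\<lambda>z. g z * rho ?t z)"
    "\<And>j x z. j \<le> 2 \<Longrightarrow> x \<in> near a b e \<Longrightarrow> rho ?t z \<noteq> 0 \<Longrightarrow> eval_norm K2 j (x - z) \<le> g z"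
    using dom[OF t] by blast
  let ?X = "near a b e" and ?S = "conv_args a b T rho e"
  have X: "open ?X" by (simp add: near_def)
  have "?S = (\<Union>z\<in>{z. \<exists>t\<in>{0..T}. rho t z \<noteq> 0}. (\<lambda>x. x - z) ` ?X)"
    unfolding conv_args_def by auto
  then have S: "open ?S" using X by (auto intro!: open_translation_subtract)
  have "real n * (b - a) \<le> real N * (b - a)" using n ab by simp
  then have "?x \<in> {a..b}" using n ab by (simp add: gx_def field_simps)
  then have x: "?x \<in> ?X" using e by (auto simp: near_def)
  obtain F where F: "\<And>h x. ev1 h x = inner h (F 0 x)" "dir_jet 1 ?X 2 F"
    by (rule rkhs_jet[OF H(1) X _ C1, of 1 2]) (simp, simp, blast)
  obtain G where G: "\<And>h x. ev2 h x = inner h (G 0 x)" "dir_jet 1 ?S 2 G"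
    and G_norm: "\<And>j x. j \<le> 2 \<Longrightarrow> x \<in> ?S \<Longrightarrow>
      (norm (G j x))\<^sup>2 = pds (replicate j (1, 0) @ replicate j (0, 1)) (\<lambda>(x, y). K2 x y) (x, x)"
    by (rule rkhs_jet[OF H(2) S _ C2, of 1 2]) (simp, simp, blast)
  have args: "x - z \<in> ?S" if "x \<in> ?X" "rho ?t z \<noteq> 0" for x z
    using that t unfolding conv_args_def by blast
  have jet: "potential_jet 1 ?X ?S 2 F G (rho ?t) g"
  proof
    show "continuous_on UNIV (\<lambda>y. inner psi (G 0 y))" for psi
      using rkhs_continuous[OF H(2) K2, of psi] by (simp add: G(1)[abs_def])
    show "0 \<le> rho ?t z" for z using rho[OF t] by (simp add: prob_density_def)
    show "rho ?t \<in> borel_measurable borel"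
      using rho[OF t] unfolding prob_density_def has_bochner_integral_iff
      by (auto dest: borel_measurable_integrable)
    show "norm (G j (x - z)) \<le> g z" if "j \<le> 2" "x \<in> ?X" "rho ?t z \<noteq> 0" for j x z
    proof -
      have "norm (G j (x - z)) = eval_norm K2 j (x - z)"
        using G_norm[OF that(1) args[OF that(2,3)]] unfolding eval_norm_def
        by (metis norm_ge_zero real_sqrt_abs abs_of_nonneg)
      then show ?thesis using g(2)[OF that] by simp
    qed
  qed (use X F G g args in auto)
  note A_eq = A_delta_eq_pot[where rho = rho, OF jet x F(1) G(1)]
  interpret potential_jet 1 ?X ?S 2 F G "rho ?t" g by (rule jet)
  have "bounded_linear (\<lambda>u. dx_fwd a b N T L rho l n * pot 1 u ?x + rho ?t ?x * pot 2 u ?x)"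
    by (intro bounded_linear_add bounded_linear_const_mult bounded_linear_pot) (use x in auto)
  then show ?thesis
    by (simp add: A_eq)
qed

lemma discrete_tikhonov:
  fixes ev1 :: "'h1::{real_inner, complete_space} \<Rightarrow> real \<Rightarrow> real"
    and ev2 :: "'h2::{real_inner, complete_space} \<Rightarrow> real \<Rightarrow> real"
    and f :: "nat \<Rightarrow> nat \<Rightarrow> real"
  assumes lam: "0 < lam1" "0 < lam2" and c: "0 \<le> T * (b - a) / (real N * real L)"
    and lin: "\<And>l n. l \<in> {1..L} \<Longrightarrow> n \<in> {1..N} \<Longrightarrow> bounded_linear (\<lambda>u. A_delta a b N T L rho ev1 ev2 u l n)"
    and rho: "\<And>l n. l \<in> {1..L} \<Longrightarrow> n \<in> {1..N} \<Longrightarrow> 0 \<le> rho (gt T L l) (gx a b N n)"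
  defines "BL \<equiv> \<lambda>u. B_NL a b N T L rho ev1 ev2 u + lamI lam1 lam2 u"
    and "R \<equiv> R_hat a b N T L rho ev1 ev2 f lam1 lam2"
  shows "bij BL" and "\<exists>!u. is_arg_min R (\<lambda>_. True) u"
    and "is_arg_min R (\<lambda>_. True) u \<Longrightarrow> u = sqrt (T * (b - a) / (real N * real L)) *\<^sub>R
      inv BL (A_NL_adj a b N T L rho ev1 ev2 f)"
proof -
  let ?A = "A_NL a b N T L rho ev1 ev2" and ?ip = "inner_C a b N T L rho"
    and ?w = "\<lambda>l n. rho (gt T L l) (gx a b N n)" and ?c = "T * (b - a) / (real N * real L)"
    and ?adj = "A_NL_adj a b N T L rho ev1 ev2" and ?B = "B_NL a b N T L rho ev1 ev2"
  define k where "k = sqrt ?c"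
  have k: "k * k = ?c" unfolding k_def using c by (rule real_sqrt_mult_self[THEN trans, OF abs_of_nonneg])
  have A: "bounded_linear (\<lambda>u. ?A u l n)" if "l \<in> {1..L}" "n \<in> {1..N}" for l n
    unfolding A_NL_def by (intro bounded_linear_const_mult lin that)
  have adj: "?ip (?A u) g = inner u (?adj g)" for u g
    unfolding A_NL_adj_def
    by (rule inner_adjoint_wrt, unfold inner_C_def)
      (intro bounded_linear_sum bounded_linear_mult_const A)
  define bf where "bf u v = ?ip (?A u) (?A v)" for u v
  have bf: "bounded_bilinear bf"
    unfolding bf_def[abs_def] inner_C_def
    by (intro bounded_bilinear_sum bounded_bilinear.comp[OF bounded_bilinear_mult]
        bounded_linear_mult_const A)
  have sym: "bf u v = bf v u" for u v
    unfolding bf_def inner_C_def by (simp add: mult_ac)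
  have psd: "0 \<le> bf u u" for u
  proof -
    have "bf u u = (\<Sum>l=1..L. \<Sum>n=1..N. ?w l n * (?A u l n)\<^sup>2)"
      unfolding bf_def inner_C_def by (simp add: power2_eq_square mult_ac)
    also have "0 \<le> \<dots>" using rho by (intro sum_nonneg mult_nonneg_nonneg) auto
    finally show ?thesis .
  qed
  have B: "bf u v = inner u (?B v)" for u v
    unfolding bf_def by (simp add: adj B_NL_def)
  define const where "const = ?c * (\<Sum>l=1..L. \<Sum>n=1..N. (f l n)\<^sup>2 * ?w l n)"
  have R: "R u = bf u u - 2 * inner u (k *\<^sub>R ?adj f) + const + inner u (lamI lam1 lam2 u)" for u
  proof -
    have "?c * (\<bar>A_delta a b N T L rho ev1 ev2 u l n - f l n\<bar>\<^sup>2 * ?w l n) =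
        ?A u l n * ?w l n * ?A u l n - 2 * k * (?A u l n * ?w l n * f l n) + ?c * ((f l n)\<^sup>2 * ?w l n)" for l n
      unfolding A_NL_def k_def[symmetric] unfolding k[symmetric]
      by (simp add: power2_eq_square algebra_simps)
    then have "?c * (\<Sum>l=1..L. \<Sum>n=1..N. \<bar>A_delta a b N T L rho ev1 ev2 u l n - f l n\<bar>\<^sup>2 * ?w l n) =
        bf u u - 2 * k * ?ip (?A u) f + const"
      unfolding bf_def inner_C_def const_def
      by (simp only: sum_distrib_left sum.distrib sum_subtractf)
    then show ?thesis
      unfolding R_def R_hat_def
      by (simp add: case_prod_unfold inner_lamI adj power2_norm_eq_inner)
  qed
  have m: "0 < min lam1 lam2" using lam by simp
  note main = regularised_least_squares[OF bf sym psd B bounded_linear_lamI lamI_symmetric m lamI_coercive R]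
  show "bij BL" unfolding BL_def by (rule main(1))
  show "\<exists>!u. is_arg_min R (\<lambda>_. True) u" by (rule main(2))
  show "u = sqrt ?c *\<^sub>R inv BL (?adj f)" if "is_arg_min R (\<lambda>_. True) u"
    using main(3)[OF that] main(4) unfolding BL_def k_def by simp
qed


section \<open>Existence and uniqueness of the regularised estimators\<close>

theorem proposition3p7:
  fixes lam1 lam2 T :: real
    and K1 K2 :: "'a::euclidean_space \<Rightarrow> 'a \<Rightarrow> real"
    and ev1 :: "'h1::{real_inner, complete_space} \<Rightarrow> 'a \<Rightarrow> real"
    and ev2 :: "'h2::{real_inner, complete_space} \<Rightarrow> 'a \<Rightarrow> real"
    and rho :: "real \<Rightarrow> 'a \<Rightarrow> real"
    and V :: 'h1 and W :: 'h2
    and K1' K2' :: "real \<Rightarrow> real \<Rightarrow> real"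
    and ev1' :: "'g1::{real_inner, complete_space} \<Rightarrow> real \<Rightarrow> real"
    and ev2' :: "'g2::{real_inner, complete_space} \<Rightarrow> real \<Rightarrow> real"
    and rho' :: "real \<Rightarrow> real \<Rightarrow> real"
    and V' :: 'g1 and W' :: 'g2
    and a b :: real and N L :: nat
    and U :: "real \<Rightarrow> real" and f :: "nat \<Rightarrow> nat \<Rightarrow> real"
  assumes "0 < lam1" and "0 < lam2" and "0 < T"
  shows
    "(mercer_kernel K1 \<and> mercer_kernel K2 \<and>
      C_b 5 (\<lambda>(x, y). K1 x y) \<and> C_b 5 (\<lambda>(x, y). K2 x y) \<and>
      rkhs K1 ev1 \<and> rkhs K2 ev2 \<and>
      densities 1 T rho \<and>
      set_borel_measurable borel ({0..T} \<times> UNIV) (\<lambda>(t, x). rho t x)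
      \<longrightarrow>
      (let A = A_op rho ev1 ev2;
           B = B_op T rho ev1 ev2;
           R = R_risk T rho ev1 ev2 (V, W) lam1 lam2;
           BlamI = (\<lambda>u. B u + lamI lam1 lam2 u)
       in range A \<subseteq> L2_space T rho \<and>
          bij BlamI \<and>
          (\<exists>!u. is_arg_min R (\<lambda>_. True) u) \<and>
          (\<forall>u. is_arg_min R (\<lambda>_. True) u \<longrightarrow> u = inv BlamI (B (V, W)))))
     \<and>
     (mercer_kernel K1' \<and> mercer_kernel K2' \<and>
      rkhs K1' ev1' \<and> rkhs K2' ev2' \<and>
      densities 2 T rho' \<and>
      a < b \<and> 1 \<le> N \<and> 1 \<le> L \<and>
      kernels_C4 a b T rho' K1' K2' \<and>
      (\<forall>l\<in>{1..L}. \<forall>n\<in>{1..N}. 0 < rho' (gt T L l) (gx a b N n)) \<and>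
      flow_data a b N T L rho' U (ev1' V') (ev2' W') f
      \<longrightarrow>
      (let B = B_NL a b N T L rho' ev1' ev2';
           R = R_hat a b N T L rho' ev1' ev2' f lam1 lam2;
           BlamI = (\<lambda>u. B u + lamI lam1 lam2 u)
       in bij BlamI \<and>
          (\<exists>!u. is_arg_min R (\<lambda>_. True) u) \<and>
          (\<forall>u. is_arg_min R (\<lambda>_. True) u \<longrightarrow>
             u = sqrt (T * (b - a) / (real N * real L)) *\<^sub>R
                   inv BlamI (A_NL_adj a b N T L rho' ev1' ev2' f))))"
proof (intro conjI impI)
  assume "mercer_kernel K1 \<and> mercer_kernel K2 \<and>
      C_b 5 (\<lambda>(x, y). K1 x y) \<and> C_b 5 (\<lambda>(x, y). K2 x y) \<and>
      rkhs K1 ev1 \<and> rkhs K2 ev2 \<and>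
      densities 1 T rho \<and>
      set_borel_measurable borel ({0..T} \<times> UNIV) (\<lambda>(t, x). rho t x)"
  then have hyps: "mercer_kernel K1" "mercer_kernel K2"
    "C_b 5 (\<lambda>(x, y). K1 x y)" "C_b 5 (\<lambda>(x, y). K2 x y)" "rkhs K1 ev1" "rkhs K2 ev2"
    "densities 1 T rho" "set_borel_measurable borel ({0..T} \<times> UNIV) (\<lambda>(t, x). rho t x)"
    by auto
  interpret density_family T rho
    by standard (use assms hyps(7,8) in \<open>auto simp: densities_def\<close>)
  obtain C where C: "\<And>u. bounded_by (C * norm u) (A_op rho ev1 ev2 u)"
    using A_op_bounded(1)[OF hyps(1-7)] by blast
  note main = continuous_tikhonov[OF assms(1,2) C A_op_bounded(2)[OF hyps(1-7)]]
  show "let A = A_op rho ev1 ev2;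
           B = B_op T rho ev1 ev2;
           R = R_risk T rho ev1 ev2 (V, W) lam1 lam2;
           BlamI = (\<lambda>u. B u + lamI lam1 lam2 u)
       in range A \<subseteq> L2_space T rho \<and>
          bij BlamI \<and>
          (\<exists>!u. is_arg_min R (\<lambda>_. True) u) \<and>
          (\<forall>u. is_arg_min R (\<lambda>_. True) u \<longrightarrow> u = inv BlamI (B (V, W)))"
    unfolding Let_def
  proof (intro conjI allI impI)
    show "range (A_op rho ev1 ev2) \<subseteq> L2_space T rho"
      using bounded_by_L2[OF C] by blast
  qed (rule main, assumption?)+
next
  assume "mercer_kernel K1' \<and> mercer_kernel K2' \<and>
      rkhs K1' ev1' \<and> rkhs K2' ev2' \<and>
      densities 2 T rho' \<and>
      a < b \<and> 1 \<le> N \<and> 1 \<le> L \<and>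
      kernels_C4 a b T rho' K1' K2' \<and>
      (\<forall>l\<in>{1..L}. \<forall>n\<in>{1..N}. 0 < rho' (gt T L l) (gx a b N n)) \<and>
      flow_data a b N T L rho' U (ev1' V') (ev2' W') f"
  then have hyps: "a < b" "mercer_kernel K2'" "rkhs K1' ev1'" "rkhs K2' ev2'"
    "\<And>t. t \<in> {0..T} \<Longrightarrow> prob_density (rho' t)" "kernels_C4 a b T rho' K1' K2'"
    and pos: "\<And>l n. l \<in> {1..L} \<Longrightarrow> n \<in> {1..N} \<Longrightarrow> 0 \<le> rho' (gt T L l) (gx a b N n)"
    by (auto simp: densities_def intro: less_imp_le)
  have c: "0 \<le> T * (b - a) / (real N * real L)" using assms(3) hyps(1) by simp
  note main = discrete_tikhonov[OF assms(1,2) c bounded_linear_A_delta[OF assms(3) hyps] pos]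
  show "let B = B_NL a b N T L rho' ev1' ev2';
           R = R_hat a b N T L rho' ev1' ev2' f lam1 lam2;
           BlamI = (\<lambda>u. B u + lamI lam1 lam2 u)
       in bij BlamI \<and>
          (\<exists>!u. is_arg_min R (\<lambda>_. True) u) \<and>
          (\<forall>u. is_arg_min R (\<lambda>_. True) u \<longrightarrow>
             u = sqrt (T * (b - a) / (real N * real L)) *\<^sub>R
                   inv BlamI (A_NL_adj a b N T L rho' ev1' ev2' f))"
    unfolding Let_def by (intro conjI allI impI; (rule main)?; assumption?)
qed

end
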